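(* Let $\omega$ be a strict open subset of $\mathbb T$ (i.e. open and $\omega\neq\mathbb T$) and let $T>0$. Let $\Omega_T := \{ z\in \mathbb C : 1<|z|<e^T,\ z/|z| \in \omega\}$. Let $f_0 \in H^2$. The following assertions are equivalent: (1) $f_0\in \mathcal{NC}_{H^2}(\omega,T)$; (2) there exists $C_{f_0,T}>0$ such that for every polynomial $p\in \mathbb C[X]$, $|\langle f_0,p\rangle_{H^2}| \leq C_{f_0,T}\|p\|_{A^2(\Omega_T)}$. Moreover, if these assertions are satisfied, the control $u$ that steers $f_0$ to $0$ in time $T$ can be chosen such that $\|u\|_{L^2([0,T]\times\omega)} \leq e^T C_{f_0,T}$, where $C_{f_0,T}$ is the constant appearing in (2).
   Context: $\mathbb T$ is the complex unit circle, identified with $\mathbb R/2\pi\mathbb Z$ via $x\mapsto e^{ix}$, with linear measure $dx$. Functions are complex valued; $f\in L^2(\mathbb T)$ is written $f(e^{ix})=\sum_{n\in\mathbb Z}\widehat f(n)e^{inx}$. The Riesz projector is $P_+f(e^{ix})=\sum_{n\ge 0}\widehat f(n)e^{inx}$, and $H^2=P_+L^2(\mathbb T)$. The inner product is $\langle f,g\rangle_{H^2}=\langle f,g\rangle_{L^2(\mathbb T)}=\int_0^{2\pi} f(e^{ix})\overline{g(e^{ix})}\,dx$. Let $S(t)f(e^{ix})=\sum_{n}\widehat f(n)e^{-|n|t}e^{inx}$ (the semigroup generated by $-|D|$, $|D|f=\sum_n|n|\widehat f(n)e^{inx}$). The $H^2$ control system is $(\partial_t+|D|)f(t,e^{ix})=P_+\mathbf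 1_\omega u(t,e^{ix})$, $f(0,\cdot)=f_0\in H^2$, with control $u\in L^2([0,T]\times\omega)$; its solution satisfies $f(T,\cdot)=S(T)f_0+\int_0^TS(T-s)P_+(\mathbf 1_\omega u(s,\cdot))\,ds$, where $\mathbf 1_\omega u$ denotes the extension of $u$ by $0$ outside $\omega$. A control $u$ steers $f_0$ to $0$ in time $T$ if $f(T,\cdot)=0$. $\mathcal{NC}_{H^2}(\omega,T)$ is the set of $f_0\in H^2$ for which there is $u\in L^2([0,T]\times\omega)$ steering $f_0$ to $0$ in time $T$. For an open set $\Omega\subset\mathbb C$, $A^2(\Omega)$ is the Bergman space of holomorphic $f$ on $\Omega$ with $\|f\|_{A^2(\Omega)}^2=\int_\Omega|f|^2\,dA<\infty$, $dA$ being planar Lebesgue measure. *)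

theory Defs
  imports "HOL-Analysis.Analysis"
begin

section \<open>The Hilbert space of square-integrable functions on the circle\<close>

definition L2_fun :: "'a measure \<Rightarrow> ('a \<Rightarrow> complex) set" where
  "L2_fun M = {f. f \<in> borel_measurable M \<and> integrable M (\<lambda>x. (cmod (f x))\<^sup>2)}"

definition L2_norm :: "'a measure \<Rightarrow> ('a \<Rightarrow> complex) \<Rightarrow> real" where
  "L2_norm M f = sqrt (LINT x|M. (cmod (f x))\<^sup>2)"

text \<open>Arc length on the unit circle. It is a Borel measure on all of \<open>\<complex>\<close>, concentrated on the
  circle; total mass is \<open>2 * pi\<close>. Functions on the circle are therefore represented by functions on
  \<open>\<complex>\<close>, whose values off the circle do not matter.\<close>

definition circle :: "complex measure" where
  "circle = distr (restrict_space lborel {0..<2 * pi}) borel cis"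

lemma sets_circle [simp, measurable_cong]: "sets circle = sets borel"
  and space_circle [simp]: "space circle = UNIV"
  by (simp_all add: circle_def)

lemma cis_measurable_interval: "cis \<in> restrict_space lborel {0..<2 * pi} \<rightarrow>\<^sub>M borel"
proof -
  have "continuous_on UNIV cis"
    unfolding cis_conv_exp[abs_def] by (intro continuous_intros)
  then have "cis \<in> borel_measurable lborel"
    by (simp add: borel_measurable_continuous_onI)
  then show ?thesis by (rule measurable_restrict_space1)
qed

lemma finite_measure_circle: "finite_measure circle"
proof
  have "emeasure circle (space circle) = emeasure lborel {0..<2 * pi}"
    unfolding circle_def
    by (subst emeasure_distr[OF cis_measurable_interval])
      (auto simp: emeasure_restrict_space space_restrict_space)
  then show "emeasure circle (space circle) \<noteq> \<infinity>" by simp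
qed

lemma L2_fun_measurable: "f \<in> L2_fun M \<Longrightarrow> f \<in> borel_measurable M"
  by (simp add: L2_fun_def)

lemma L2_fun_integrable_mult_cnj:
  assumes f: "f \<in> L2_fun M" and g: "g \<in> L2_fun M"
  shows "integrable M (\<lambda>x. f x * cnj (g x))"
proof (rule Bochner_Integration.integrable_bound[where f="\<lambda>x. (cmod (f x))\<^sup>2 + (cmod (g x))\<^sup>2"])
  show "integrable M (\<lambda>x. (cmod (f x))\<^sup>2 + (cmod (g x))\<^sup>2)"
    using f g by (auto simp: L2_fun_def)
  show "(\<lambda>x. f x * cnj (g x)) \<in> borel_measurable M"
    using f g by (auto simp: L2_fun_def intro!: borel_measurable_times
        measurable_compose[OF _ borel_measurable_continuous_onI[of cnj]] continuous_intros)
  show "AE x in M. norm (f x * cnj (g x)) \<le> norm ((cmod (f x))\<^sup>2 + (cmod (g x))\<^sup>2)"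
  proof (rule AE_I2)
    fix x
    have "2 * (cmod (f x) * cmod (g x)) \<le> (cmod (f x))\<^sup>2 + (cmod (g x))\<^sup>2"
      using sum_squares_bound[of "cmod (f x)" "cmod (g x)"] by simp
    moreover have "0 \<le> cmod (f x) * cmod (g x)" by simp
    ultimately have "cmod (f x) * cmod (g x) \<le> (cmod (f x))\<^sup>2 + (cmod (g x))\<^sup>2" by linarith
    then show "norm (f x * cnj (g x)) \<le> norm ((cmod (f x))\<^sup>2 + (cmod (g x))\<^sup>2)"
      by (simp add: norm_mult)
  qed
qed

lemma L2_fun_zero: "(\<lambda>x. 0) \<in> L2_fun M"
  by (simp add: L2_fun_def)

lemma L2_fun_cmult:
  assumes "f \<in> L2_fun M" shows "(\<lambda>x. c * f x) \<in> L2_fun M"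
  using assms by (auto simp: L2_fun_def norm_mult power_mult_distrib)

lemma L2_fun_add:
  assumes f: "f \<in> L2_fun M" and g: "g \<in> L2_fun M"
  shows "(\<lambda>x. f x + g x) \<in> L2_fun M"
proof -
  have "integrable M (\<lambda>x. (cmod (f x + g x))\<^sup>2)"
  proof (rule Bochner_Integration.integrable_bound[where f="\<lambda>x. 2 * (cmod (f x))\<^sup>2 + 2 * (cmod (g x))\<^sup>2"])
    show "integrable M (\<lambda>x. 2 * (cmod (f x))\<^sup>2 + 2 * (cmod (g x))\<^sup>2)"
      using f g by (auto simp: L2_fun_def)
    show "(\<lambda>x. (cmod (f x + g x))\<^sup>2) \<in> borel_measurable M"
      using f g by (auto simp: L2_fun_def)
    show "AE x in M. norm ((cmod (f x + g x))\<^sup>2) \<le> norm (2 * (cmod (f x))\<^sup>2 + 2 * (cmod (g x))\<^sup>2)"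
    proof (rule AE_I2)
      fix x
      have "(cmod (f x + g x))\<^sup>2 \<le> (cmod (f x) + cmod (g x))\<^sup>2"
        by (intro power_mono norm_triangle_ineq) auto
      also have "\<dots> \<le> 2 * (cmod (f x))\<^sup>2 + 2 * (cmod (g x))\<^sup>2"
        using sum_squares_bound[of "cmod (f x)" "cmod (g x)"] by (simp add: power2_sum)
      finally show "norm ((cmod (f x + g x))\<^sup>2) \<le> norm (2 * (cmod (f x))\<^sup>2 + 2 * (cmod (g x))\<^sup>2)"
        by simp
    qed
  qed
  then show ?thesis using f g by (auto simp: L2_fun_def)
qed

lemma L2_fun_uminus: "f \<in> L2_fun M \<Longrightarrow> (\<lambda>x. - f x) \<in> L2_fun M"
  using L2_fun_cmult[of f M "-1"] by simp

lemma L2_fun_diff: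
  assumes "f \<in> L2_fun M" "g \<in> L2_fun M" shows "(\<lambda>x. f x - g x) \<in> L2_fun M"
  using L2_fun_add[OF assms(1) L2_fun_uminus[OF assms(2)]] by simp

lemma L2_fun_scaleR: "f \<in> L2_fun M \<Longrightarrow> (\<lambda>x. r *\<^sub>R f x) \<in> L2_fun M"
  using L2_fun_cmult[of f M "of_real r"] by (simp add: scaleR_conv_of_real)

lemma L2_fun_bounded:
  assumes M: "finite_measure M" and f: "f \<in> borel_measurable M"
    and B: "\<And>x. x \<in> space M \<Longrightarrow> cmod (f x) \<le> B"
  shows "f \<in> L2_fun M"
proof -
  interpret finite_measure M by fact
  have "integrable M (\<lambda>x. (cmod (f x))\<^sup>2)"
    by (rule integrable_const_bound[where B="B\<^sup>2"])
      (use f B in \<open>auto intro!: power_mono\<close>)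
  with f show ?thesis by (simp add: L2_fun_def)
qed

text \<open>Equality almost everywhere of square-integrable functions; the quotient is
  \<open>L\<^sup>2\<close> of the circle.\<close>

definition L2_eq :: "(complex \<Rightarrow> complex) \<Rightarrow> (complex \<Rightarrow> complex) \<Rightarrow> bool" where
  "L2_eq f g \<longleftrightarrow> f \<in> L2_fun circle \<and> g \<in> L2_fun circle \<and> (AE z in circle. f z = g z)"

quotient_type L2T = "complex \<Rightarrow> complex" / partial: L2_eq
proof (rule part_equivpI)
  show "\<exists>f. L2_eq f f"
    by (rule exI[of _ "\<lambda>_. 0"]) (simp add: L2_eq_def L2_fun_zero)
  show "symp L2_eq"
    by (auto simp: symp_def L2_eq_def elim: AE_mp)
  show "transp L2_eq"
  proof (rule transpI)
    fix f g h assume "L2_eq f g" "L2_eq g h"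
    then show "L2_eq f h"
      unfolding L2_eq_def by (auto elim: AE_mp)
  qed
qed

text \<open>The \<open>inner\<close> below is the real part of the complex inner product \<open>L2_cinner\<close>
  defined later; the class \<^class>\<open>real_inner\<close> requires a real one.\<close>

instantiation L2T :: real_inner
begin

lift_definition zero_L2T :: L2T is "\<lambda>_. 0"
  by (simp add: L2_eq_def L2_fun_zero)

lift_definition plus_L2T :: "L2T \<Rightarrow> L2T \<Rightarrow> L2T" is "\<lambda>f g z. f z + g z"
  unfolding L2_eq_def by (auto intro: L2_fun_add)

lift_definition minus_L2T :: "L2T \<Rightarrow> L2T \<Rightarrow> L2T" is "\<lambda>f g z. f z - g z"
  unfolding L2_eq_def by (auto intro: L2_fun_diff)

lift_definition uminus_L2T :: "L2T \<Rightarrow> L2T" is "\<lambda>f z. - f z"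
  unfolding L2_eq_def by (auto intro: L2_fun_uminus)

lift_definition scaleR_L2T :: "real \<Rightarrow> L2T \<Rightarrow> L2T" is "\<lambda>r f z. r *\<^sub>R f z"
  unfolding L2_eq_def by (auto intro: L2_fun_scaleR)

lift_definition inner_L2T :: "L2T \<Rightarrow> L2T \<Rightarrow> real" is "\<lambda>f g. Re (LINT z|circle. f z * cnj (g z))"
proof -
  fix f f' g g' assume fg: "L2_eq f f'" "L2_eq g g'"
  have "AE z in circle. f z * cnj (g z) = f' z * cnj (g' z)"
    using fg unfolding L2_eq_def by (auto elim!: AE_mp)
  then have "(LINT z|circle. f z * cnj (g z)) = (LINT z|circle. f' z * cnj (g' z))"
    using fg[unfolded L2_eq_def]
    by (intro integral_cong_AE borel_measurable_integrable L2_fun_integrable_mult_cnj) auto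
  then show "Re (LINT z|circle. f z * cnj (g z)) = Re (LINT z|circle. f' z * cnj (g' z))"
    by simp
qed

lift_definition norm_L2T :: "L2T \<Rightarrow> real" is "L2_norm circle"
proof -
  fix f g assume fg: "L2_eq f g"
  then have "AE z in circle. (cmod (f z))\<^sup>2 = (cmod (g z))\<^sup>2"
    unfolding L2_eq_def by (auto elim!: AE_mp)
  then show "L2_norm circle f = L2_norm circle g"
    using fg unfolding L2_norm_def L2_eq_def L2_fun_def
    by (intro arg_cong[where f=sqrt] integral_cong_AE) auto
qed

definition dist_L2T :: "L2T \<Rightarrow> L2T \<Rightarrow> real" where
  "dist_L2T f g = norm (f - g)"

definition sgn_L2T :: "L2T \<Rightarrow> L2T" where
  "sgn_L2T f = scaleR (inverse (norm f)) f"

definition uniformity_L2T :: "(L2T \<times> L2T) filter" where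
  "uniformity_L2T = (INF e\<in>{0 <..}. principal {(x, y). dist x y < e})"

definition open_L2T :: "L2T set \<Rightarrow> bool" where
  "open_L2T U = (\<forall>x\<in>U. eventually (\<lambda>(x', y). x' = x \<longrightarrow> y \<in> U) uniformity)"

instance
proof
  fix x y z :: L2T and r s :: real
  show "x + y + z = x + (y + z)"
    by transfer (auto simp: L2_eq_def add.assoc intro!: L2_fun_add)
  show "x + y = y + x"
    by transfer (auto simp: L2_eq_def add.commute intro!: L2_fun_add)
  show "0 + x = x"
    by transfer (auto simp: L2_eq_def)
  show "- x + x = 0"
    by transfer (auto simp: L2_eq_def L2_fun_zero)
  show "x - y = x + - y"
    by transfer (auto simp: L2_eq_def intro!: L2_fun_diff)
  show "r *\<^sub>R (x + y) = r *\<^sub>R x + r *\<^sub>R y"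
    by transfer (auto simp: L2_eq_def scaleR_add_right intro!: L2_fun_add L2_fun_scaleR)
  show "(r + s) *\<^sub>R x = r *\<^sub>R x + s *\<^sub>R x"
    by transfer (auto simp: L2_eq_def scaleR_add_left intro!: L2_fun_add L2_fun_scaleR)
  show "r *\<^sub>R s *\<^sub>R x = (r * s) *\<^sub>R x"
    by transfer (auto simp: L2_eq_def intro!: L2_fun_scaleR)
  show "1 *\<^sub>R x = x"
    by transfer (auto simp: L2_eq_def)
  show "dist x y = norm (x - y)"
    by (fact dist_L2T_def)
  show "sgn x = scaleR (inverse (norm x)) x"
    by (fact sgn_L2T_def)
  show "(uniformity :: (L2T \<times> L2T) filter) = (INF e\<in>{0 <..}. principal {(x, y). dist x y < e})"
    by (fact uniformity_L2T_def)
  show "open U = (\<forall>x\<in>U. eventually (\<lambda>(x', y). x' = x \<longrightarrow> y \<in> U) uniformity)" for U :: "L2T set"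
    by (fact open_L2T_def)
  show "inner x y = inner y x"
  proof transfer
    fix f g assume "L2_eq f f" "L2_eq g g"
    have "(LINT z|circle. g z * cnj (f z)) = (LINT z|circle. cnj (f z * cnj (g z)))"
      by (simp add: mult.commute)
    also have "\<dots> = cnj (LINT z|circle. f z * cnj (g z))"
      by (rule Bochner_Integration.integral_cnj)
    finally show "Re (LINT z|circle. f z * cnj (g z)) = Re (LINT z|circle. g z * cnj (f z))"
      by simp
  qed
  show "inner (x + y) z = inner x z + inner y z"
    by transfer (simp add: L2_eq_def ring_distribs L2_fun_integrable_mult_cnj)
  show "inner (r *\<^sub>R x) y = r * inner x y"
    by transfer (simp add: L2_eq_def)
  have sq: "Re (LINT z|circle. f z * cnj (f z)) = (LINT z|circle. (cmod (f z))\<^sup>2)" for f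
    by (simp only: complex_norm_square[symmetric] integral_complex_of_real Re_complex_of_real)
  show "0 \<le> inner x x"
    by transfer (simp add: sq)
  show "inner x x = 0 \<longleftrightarrow> x = 0"
  proof transfer
    fix f assume "L2_eq f f"
    then show "Re (LINT z|circle. f z * cnj (f z)) = 0 \<longleftrightarrow> L2_eq f (\<lambda>_. 0)"
      unfolding sq L2_eq_def
      by (subst integral_nonneg_eq_0_iff_AE) (auto simp: L2_fun_def L2_fun_zero)
  qed
  show "norm x = sqrt (inner x x)"
    by transfer (simp add: L2_norm_def sq)
qed

end

text \<open>The class of a function; \<open>0\<close> for functions that are not square-integrable.\<close>

definition L2T_of :: "(complex \<Rightarrow> complex) \<Rightarrow> L2T" where
  "L2T_of f = (if f \<in> L2_fun circle then abs_L2T f else 0)"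

lemma L2T_cases:
  obtains f where "f \<in> L2_fun circle" "x = L2T_of f"
proof -
  obtain f where "L2_eq f f" "x = abs_L2T f"
    by (metis Quotient_L2T Quotient_abs_rep Quotient_rep_reflp)
  then show thesis
    using that by (auto simp: L2T_of_def L2_eq_def)
qed

lemma norm_L2T_of: "f \<in> L2_fun circle \<Longrightarrow> norm (L2T_of f) = L2_norm circle f"
  by (simp add: L2T_of_def norm_L2T.abs_eq L2_eq_def)

lemma L2T_of_add:
  "f \<in> L2_fun circle \<Longrightarrow> g \<in> L2_fun circle \<Longrightarrow> L2T_of (\<lambda>z. f z + g z) = L2T_of f + L2T_of g"
  by (simp add: L2T_of_def plus_L2T.abs_eq L2_eq_def L2_fun_add)

lemma L2T_of_diff:
  "f \<in> L2_fun circle \<Longrightarrow> g \<in> L2_fun circle \<Longrightarrow> L2T_of (\<lambda>z. f z - g z) = L2T_of f - L2T_of g"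
  by (simp add: L2T_of_def minus_L2T.abs_eq L2_eq_def L2_fun_diff)

lemma L2T_of_zero: "L2T_of (\<lambda>_. 0) = 0"
  by (simp add: L2T_of_def zero_L2T.abs_eq L2_fun_zero)

lemma dist_L2T_of:
  assumes "f \<in> L2_fun circle" "g \<in> L2_fun circle"
  shows "(dist (L2T_of f) (L2T_of g))\<^sup>2 = (LINT z|circle. (cmod (f z - g z))\<^sup>2)"
  using assms
  by (simp add: dist_norm L2T_of_diff[symmetric] norm_L2T_of L2_fun_diff L2_norm_def)

text \<open>Completeness and separability, so that the Bochner integral of functions with values in
  \<^typ>\<open>L2T\<close> is available.\<close>

lemma L2_fast_Cauchy_limit:
  fixes f :: "nat \<Rightarrow> complex \<Rightarrow> complex"
  assumes f: "\<And>k. f k \<in> L2_fun circle"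
    and fast: "\<And>k m n. k \<le> m \<Longrightarrow> k \<le> n \<Longrightarrow>
      (LINT z|circle. (cmod (f m z - f n z))\<^sup>2) \<le> (1/4) ^ k"
  obtains g where "g \<in> L2_fun circle"
    "\<And>k. (LINT z|circle. (cmod (f k z - g z))\<^sup>2) \<le> (1/4) ^ k"
proof -
  interpret finite_measure circle by (rule finite_measure_circle)
  have fm [measurable]: "f k \<in> borel_measurable circle" for k
    using f by (rule L2_fun_measurable)
  have int: "integrable circle (\<lambda>z. (cmod (f m z - f n z))\<^sup>2)" for m n
    using L2_fun_diff[OF f[of m] f[of n]] by (simp add: L2_fun_def)
  have nn: "(\<integral>\<^sup>+z. ennreal ((cmod (f m z - f n z))\<^sup>2) \<partial>circle) \<le> ennreal ((1/4) ^ k)"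
    if "k \<le> m" "k \<le> n" for k m n
    by (subst nn_integral_eq_integral[OF int]) (auto intro!: ennreal_leI fast that)
  define d where "d k z = cmod (f (Suc k) z - f k z)" for k z
  have dm [measurable]: "d k \<in> borel_measurable circle" for k
    unfolding d_def by measurable
  define g where "g z = lim (\<lambda>k. f k z)" for z
  define \<mu> where "\<mu> = measure circle (space circle)"
  have d_le: "d k z \<le> 2 ^ k * (d k z)\<^sup>2 + (1/2) ^ k" for k z
  proof (cases "d k z \<le> (1/2) ^ k")
    case True
    then show ?thesis by (simp add: add_increasing)
  next
    case False
    then have "1 \<le> 2 ^ k * d k z"
      by (simp add: power_divide field_simps)
    then have "d k z * 1 \<le> d k z * (2 ^ k * d k z)"
      by (intro mult_left_mono) (auto simp: d_def)
    then show ?thesis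
      by (simp add: power2_eq_square mult_ac add_increasing2)
  qed
  have int_d: "(\<integral>\<^sup>+z. ennreal (d k z) \<partial>circle) \<le> ennreal ((1/2) ^ k * (1 + \<mu>))" for k
  proof -
    have d2: "integrable circle (\<lambda>z. (d k z)\<^sup>2)"
      unfolding d_def by (rule int)
    have "(\<integral>\<^sup>+z. ennreal (d k z) \<partial>circle) \<le> (\<integral>\<^sup>+z. ennreal (2 ^ k * (d k z)\<^sup>2 + (1/2) ^ k) \<partial>circle)"
      by (intro nn_integral_mono ennreal_leI d_le)
    also have "\<dots> = ennreal (LINT z|circle. 2 ^ k * (d k z)\<^sup>2 + (1/2) ^ k)"
      by (rule nn_integral_eq_integral) (auto intro!: d2)
    also have "\<dots> \<le> ennreal ((1/2) ^ k * (1 + \<mu>))"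
    proof (rule ennreal_leI)
      have "(LINT z|circle. 2 ^ k * (d k z)\<^sup>2 + (1/2) ^ k) = 2 ^ k * (LINT z|circle. (d k z)\<^sup>2) + (1/2) ^ k * \<mu>"
        using d2 by (simp add: \<mu>_def)
      also have "\<dots> \<le> 2 ^ k * (1/4) ^ k + (1/2) ^ k * \<mu>"
        using fast[of k "Suc k" k] by (intro add_mono mult_left_mono) (auto simp: d_def)
      also have "2 ^ k * (1/4) ^ k = (1/2 :: real) ^ k"
        by (simp add: power_mult_distrib[symmetric])
      finally show "(LINT z|circle. 2 ^ k * (d k z)\<^sup>2 + (1/2) ^ k) \<le> (1/2) ^ k * (1 + \<mu>)"
        by (simp add: ring_distribs)
    qed
    finally show ?thesis .
  qed
  have "(\<integral>\<^sup>+z. (\<Sum>k. ennreal (d k z)) \<partial>circle) = (\<Sum>k. \<integral>\<^sup>+z. ennreal (d k z) \<partial>circle)"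
    by (rule nn_integral_suminf) simp
  also have "\<dots> \<le> (\<Sum>k. ennreal ((1/2) ^ k * (1 + \<mu>)))"
    by (intro suminf_le int_d) auto
  also have "\<dots> < \<infinity>"
  proof -
    have "summable (\<lambda>k. (1/2 :: real) ^ k * (1 + \<mu>))"
      by (intro summable_mult2 summable_geometric) auto
    then show ?thesis
      by (subst suminf_ennreal2) (auto simp: \<mu>_def)
  qed
  finally have "(\<integral>\<^sup>+z. (\<Sum>k. ennreal (d k z)) \<partial>circle) \<noteq> \<infinity>" by simp
  then have "AE z in circle. (\<Sum>k. ennreal (d k z)) \<noteq> \<infinity>"
    by (intro nn_integral_PInf_AE) auto
  then have lim: "AE z in circle. (\<lambda>k. f k z) \<longlonglongrightarrow> g z"
  proof (eventually_elim)
    case (elim z)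
    then have "summable (\<lambda>k. d k z)"
      by (intro summable_suminf_not_top) (auto simp: d_def)
    then have "summable (\<lambda>k. f (Suc k) z - f k z)"
      unfolding d_def by (rule summable_norm_cancel)
    then have "convergent (\<lambda>n. \<Sum>k<n. f (Suc k) z - f k z)"
      by (simp add: summable_iff_convergent)
    then have "convergent (\<lambda>n. f n z - f 0 z)"
      by (simp only: sum_lessThan_telescope[of "\<lambda>n. f n z"])
    then have "convergent (\<lambda>n. f n z - f 0 z + f 0 z)"
      by (intro convergent_add convergent_const)
    then show ?case
      by (simp add: g_def convergent_LIMSEQ_iff)
  qed
  have gm [measurable]: "g \<in> borel_measurable circle"
    unfolding g_def[abs_def] by (rule borel_measurable_lim_metric) simp
  have bound: "(\<integral>\<^sup>+z. ennreal ((cmod (f k z - g z))\<^sup>2) \<partial>circle) \<le> ennreal ((1/4) ^ k)" for k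
  proof -
    have "(\<integral>\<^sup>+z. ennreal ((cmod (f k z - g z))\<^sup>2) \<partial>circle)
        = (\<integral>\<^sup>+z. liminf (\<lambda>n. ennreal ((cmod (f k z - f n z))\<^sup>2)) \<partial>circle)"
    proof (rule nn_integral_cong_AE)
      show "AE z in circle. ennreal ((cmod (f k z - g z))\<^sup>2) = liminf (\<lambda>n. ennreal ((cmod (f k z - f n z))\<^sup>2))"
        using lim
      proof eventually_elim
        case (elim z)
        then have "(\<lambda>n. ennreal ((cmod (f k z - f n z))\<^sup>2)) \<longlonglongrightarrow> ennreal ((cmod (f k z - g z))\<^sup>2)"
          by (intro tendsto_intros)
        then show ?case
          by (rule lim_imp_Liminf[OF trivial_limit_sequentially, symmetric])
      qed
    qed
    also have "\<dots> \<le> liminf (\<lambda>n. \<integral>\<^sup>+z. ennreal ((cmod (f k z - f n z))\<^sup>2) \<partial>circle)"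
      by (rule nn_integral_liminf) simp
    also have "\<dots> \<le> ennreal ((1/4) ^ k)"
    proof (rule Liminf_le)
      show "eventually (\<lambda>n. (\<integral>\<^sup>+z. ennreal ((cmod (f k z - f n z))\<^sup>2) \<partial>circle) \<le> ennreal ((1/4) ^ k)) sequentially"
        using eventually_ge_at_top[of k] by eventually_elim (rule nn, auto)
    qed simp
    finally show ?thesis .
  qed
  have int_g: "integrable circle (\<lambda>z. (cmod (f k z - g z))\<^sup>2)" for k
    by (rule integrableI_bounded) (use bound[of k] in \<open>auto intro: le_less_trans\<close>)
  then have "(\<lambda>z. f 0 z - g z) \<in> L2_fun circle"
    by (simp add: L2_fun_def)
  from L2_fun_diff[OF f[of 0] this] have "g \<in> L2_fun circle" by simp
  moreover have "(LINT z|circle. (cmod (f k z - g z))\<^sup>2) \<le> (1/4) ^ k" for k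
    using bound[of k] by (subst (asm) nn_integral_eq_integral[OF int_g]) auto
  ultimately show thesis by (rule that)
qed

instance L2T :: banach
proof
  fix X :: "nat \<Rightarrow> L2T" assume X: "Cauchy X"
  have "\<exists>N. \<forall>m\<ge>N. \<forall>n\<ge>N. dist (X m) (X n) < (1/2) ^ k" for k
    by (rule metric_CauchyD[OF X]) simp
  then obtain N where N: "\<And>k m n. m \<ge> N k \<Longrightarrow> n \<ge> N k \<Longrightarrow> dist (X m) (X n) < (1/2) ^ k"
    by metis
  define r where "r k = (\<Sum>i\<le>k. N i) + k" for k
  have r: "strict_mono r"
    by (rule strict_monoI_Suc) (simp add: r_def)
  have rN: "N k \<le> r m" if "k \<le> m" for k m
    using member_le_sum[of k "{..m}" N] that by (simp add: r_def)
  have "\<forall>k. \<exists>f. f \<in> L2_fun circle \<and> X (r k) = L2T_of f"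
    by (metis L2T_cases)
  then obtain f where f: "\<And>k. f k \<in> L2_fun circle" "\<And>k. X (r k) = L2T_of (f k)"
    by metis
  have fast: "(LINT z|circle. (cmod (f m z - f n z))\<^sup>2) \<le> (1/4) ^ k" if "k \<le> m" "k \<le> n" for k m n
  proof -
    have "(dist (X (r m)) (X (r n)))\<^sup>2 \<le> ((1/2) ^ k)\<^sup>2"
      using N[OF rN rN, OF that] by (intro power_mono) auto
    also have "((1/2 :: real) ^ k)\<^sup>2 = (1/4) ^ k"
      by (simp add: power2_eq_square flip: power_mult_distrib)
    finally show ?thesis
      by (simp add: f dist_L2T_of)
  qed
  obtain g where g: "g \<in> L2_fun circle" "\<And>k. (LINT z|circle. (cmod (f k z - g z))\<^sup>2) \<le> (1/4) ^ k"
    by (rule L2_fast_Cauchy_limit[of f, OF f(1) fast]) blast+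
  have "(\<lambda>k. (dist ((X \<circ> r) k) (L2T_of g))\<^sup>2) \<longlonglongrightarrow> 0"
  proof (rule tendsto_sandwich[of "\<lambda>_. 0" _ _ "\<lambda>k. (1/4) ^ k"])
    show "\<forall>\<^sub>F k in sequentially. (dist ((X \<circ> r) k) (L2T_of g))\<^sup>2 \<le> (1/4) ^ k"
      using g f by (simp add: dist_L2T_of)
  qed (auto intro: LIMSEQ_realpow_zero)
  then have "(\<lambda>k. dist ((X \<circ> r) k) (L2T_of g)) \<longlonglongrightarrow> 0"
    using tendsto_real_sqrt[of "\<lambda>k. (dist ((X \<circ> r) k) (L2T_of g))\<^sup>2" 0] by simp
  then have "(X \<circ> r) \<longlonglongrightarrow> L2T_of g"
    by (rule iffD2[OF tendsto_dist_iff])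
  then have "X \<longlonglongrightarrow> L2T_of g"
    by (rule Cauchy_converges_subseq[OF X r])
  then show "convergent X" by (rule convergentI)
qed

lemma L2T_of_dominated:
  assumes s: "\<And>n. s n \<in> borel_measurable circle" and f: "f \<in> borel_measurable circle"
    and w: "integrable circle (\<lambda>z. (w z)\<^sup>2)"
    and le: "\<And>n z. cmod (s n z) \<le> w z"
    and lim: "\<And>z. (\<lambda>n. s n z) \<longlonglongrightarrow> f z"
  shows "(\<lambda>n. L2T_of (s n)) \<longlonglongrightarrow> L2T_of f"
proof -
  note [measurable] = s f
  have le': "cmod (f z) \<le> w z" for z
    by (rule Lim_bounded[OF tendsto_norm[OF lim], of 0]) (auto intro: le)
  have w0: "0 \<le> w z" for z
    using le'[of z] norm_ge_zero[of "f z"] by linarith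
  have sL: "s n \<in> L2_fun circle" for n
    unfolding L2_fun_def
    using Bochner_Integration.integrable_bound[OF w, of "\<lambda>z. (cmod (s n z))\<^sup>2"] le w0
    by (auto intro!: power_mono AE_I2)
  have fL: "f \<in> L2_fun circle"
    unfolding L2_fun_def
    using Bochner_Integration.integrable_bound[OF w, of "\<lambda>z. (cmod (f z))\<^sup>2"] le' w0
    by (auto intro!: power_mono AE_I2)
  have "(\<lambda>n. LINT z|circle. (cmod (s n z - f z))\<^sup>2) \<longlonglongrightarrow> (LINT z|circle. 0)"
  proof (rule integral_dominated_convergence[where w="\<lambda>z. 4 * (w z)\<^sup>2"])
    show "AE z in circle. (\<lambda>n. (cmod (s n z - f z))\<^sup>2) \<longlonglongrightarrow> 0"
    proof (rule AE_I2)
      fix z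
      have "(\<lambda>n. (cmod (s n z - f z))\<^sup>2) \<longlonglongrightarrow> (cmod (f z - f z))\<^sup>2"
        by (intro tendsto_intros lim)
      then show "(\<lambda>n. (cmod (s n z - f z))\<^sup>2) \<longlonglongrightarrow> 0" by simp
    qed
    show "AE z in circle. norm ((cmod (s n z - f z))\<^sup>2) \<le> 4 * (w z)\<^sup>2" for n
    proof (rule AE_I2)
      fix z
      have "cmod (s n z - f z) \<le> 2 * w z"
        using norm_triangle_ineq4[of "s n z" "f z"] le[of n z] le'[of z] by linarith
      then have "(cmod (s n z - f z))\<^sup>2 \<le> (2 * w z)\<^sup>2"
        by (intro power_mono) auto
      then show "norm ((cmod (s n z - f z))\<^sup>2) \<le> 4 * (w z)\<^sup>2"
        by (simp add: power_mult_distrib)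
    qed
  qed (use w in auto)
  then have "(\<lambda>n. (dist (L2T_of (s n)) (L2T_of f))\<^sup>2) \<longlonglongrightarrow> 0"
    by (simp add: dist_L2T_of sL fL)
  then have "(\<lambda>n. dist (L2T_of (s n)) (L2T_of f)) \<longlonglongrightarrow> 0"
    using tendsto_real_sqrt[of "\<lambda>n. (dist (L2T_of (s n)) (L2T_of f))\<^sup>2" 0] by simp
  then show ?thesis
    by (rule iffD2[OF tendsto_dist_iff])
qed

lemma L2T_countable_dense:
  obtains D :: "L2T set" where "countable D" "closure D = UNIV"
proof -
  interpret finite_measure circle by (rule finite_measure_circle)
  obtain Q :: "complex set" where Q: "countable Q" "\<And>X. open X \<Longrightarrow> X \<noteq> {} \<Longrightarrow> \<exists>d\<in>Q. d \<in> X"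
    by (erule countable_dense_setE)
  obtain B :: "complex set set" where B: "countable B" "topological_basis B"
    using ex_countable_basis by blast
  define F where "F = Union ` {S. finite S \<and> S \<subseteq> B}"
  have F_count: "countable F"
    unfolding F_def by (intro countable_image countable_Collect_finite_subset B)
  have F_open: "open U" if "U \<in> F" for U
    using that topological_basis_open[OF B(2)] unfolding F_def by (auto intro: open_Union)
  define h where "h c A = L2T_of (\<lambda>z. c * indicator A z)" for c :: complex and A
  define D where "D = (\<lambda>xs. sum_list (map (\<lambda>(c, A). h c A) xs)) ` lists (Q \<times> F)"
  define K where "K = closure D"
  have "countable D"
    unfolding D_def by (intro countable_image countable_lists countable_SIGMA Q F_count)
  have K_closed: "x \<in> K" if "\<And>n. X n \<in> K" "X \<longlonglongrightarrow> x" for X x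
    using that closed_sequentially[of K] unfolding K_def by blast
  have K_add: "x + y \<in> K" if "x \<in> K" "y \<in> K" for x y
  proof -
    have D_add: "a + b \<in> D" if ab: "a \<in> D" "b \<in> D" for a b
    proof -
      from ab obtain xs ys where "xs \<in> lists (Q \<times> F)" "ys \<in> lists (Q \<times> F)"
        "a = sum_list (map (\<lambda>(c, A). h c A) xs)" "b = sum_list (map (\<lambda>(c, A). h c A) ys)"
        unfolding D_def by blast
      then show ?thesis
        unfolding D_def by (intro image_eqI[of _ _ "xs @ ys"]) auto
    qed
    from that obtain X Y where "\<And>n. X n \<in> D" "X \<longlonglongrightarrow> x" "\<And>n. Y n \<in> D" "Y \<longlonglongrightarrow> y"
      unfolding K_def closure_sequential by blast
    then have "(\<lambda>n. X n + Y n) \<longlonglongrightarrow> x + y" "\<And>n. X n + Y n \<in> D"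
      by (auto intro: tendsto_add D_add)
    then show ?thesis
      unfolding K_def closure_sequential by (intro exI[of _ "\<lambda>n. X n + Y n"]) auto
  qed
  have D_K: "D \<subseteq> K" unfolding K_def by (rule closure_subset)
  have h_meas: "(\<lambda>z. c * indicator A z) \<in> borel_measurable circle" if "A \<in> sets borel" for c :: complex and A
    using that by simp
  have h_L2: "(\<lambda>z. c * indicator A z) \<in> L2_fun circle" if "A \<in> sets borel" for c :: complex and A
    by (rule L2_fun_bounded[OF finite_measure_circle h_meas[OF that], of _ "cmod c"])
      (auto simp: norm_mult indicator_def)
  have zero_K: "0 \<in> K"
  proof -
    have "(0::L2T) \<in> D" unfolding D_def by (intro image_eqI[of _ _ "[]"]) auto
    then show ?thesis using D_K by auto
  qed
  have K_F: "h c U \<in> K" if U: "U \<in> F" for c U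
  proof -
    have "c \<in> closure Q"
      unfolding closure_approachable using Q(2)[of "ball c e" for e]
      by (metis centre_in_ball dist_commute empty_iff mem_ball open_ball)
    then obtain q where q: "\<And>n. q n \<in> Q" "q \<longlonglongrightarrow> c"
      unfolding closure_sequential by blast
    from convergent_imp_bounded[OF q(2)] obtain b where b: "\<And>n. cmod (q n) \<le> b"
      unfolding bounded_iff by auto
    then have "0 \<le> b" using norm_ge_zero order_trans by blast
    have "(\<lambda>n. h (q n) U) \<longlonglongrightarrow> h c U"
      unfolding h_def
    proof (rule L2T_of_dominated[where w="\<lambda>_. b"])
      show "cmod (q n * indicator U z) \<le> b" for n z
        using b[of n] \<open>0 \<le> b\<close> by (auto simp: norm_mult indicator_def)
      show "(\<lambda>n. q n * indicator U z) \<longlonglongrightarrow> c * indicator U z" for z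
        by (intro tendsto_intros q)
    qed (use h_meas[OF borel_open[OF F_open[OF U]]] in auto)
    moreover have "h (q n) U \<in> K" for n
    proof -
      have "h (q n) U \<in> D"
        unfolding D_def using q(1)[of n] U by (intro image_eqI[of _ _ "[(q n, U)]"]) auto
      then show ?thesis using D_K by auto
    qed
    ultimately show ?thesis using K_closed[of "\<lambda>n. h (q n) U"] by blast
  qed
  have h_lim: "h c A \<in> K"
    if An: "\<And>n. h c (An n) \<in> K" "\<And>n. An n \<in> sets borel"
      and A: "A \<in> sets borel"
      and lim: "\<And>z. eventually (\<lambda>n. z \<in> An n \<longleftrightarrow> z \<in> A) sequentially" for c An A
  proof -
    have "(\<lambda>n. h c (An n)) \<longlonglongrightarrow> h c A"
      unfolding h_def
    proof (rule L2T_of_dominated[where w="\<lambda>_. cmod c"])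
      show "cmod (c * indicator (An n) z) \<le> cmod c" for n z
        by (auto simp: norm_mult indicator_def)
      show "(\<lambda>n. c * indicator (An n) z) \<longlonglongrightarrow> c * indicator A z" for z
        by (rule tendsto_eventually) (use lim[of z] in eventually_elim, auto simp: indicator_def)
    qed (use h_meas An A in auto)
    then show ?thesis using K_closed[of "\<lambda>n. h c (An n)"] An(1) by blast
  qed
  have K_open: "h c U \<in> K" if U: "open U" for c U
  proof -
    obtain B' where B': "B' \<subseteq> B" "\<Union>B' = U"
      using B(2) U unfolding topological_basis_def by metis
    show ?thesis
    proof (cases "B' = {}")
      case True
      then have "h c U = 0" using B'(2) L2T_of_zero by (auto simp: h_def)
      then show ?thesis using zero_K by simp
    next
      case False
      define e where "e = from_nat_into B'"
      have e: "range e = B'"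
        unfolding e_def using False countable_subset[OF B'(1) B(1)] by (rule range_from_nat_into)
      have inF: "(\<Union>i\<le>n. e i) \<in> F" for n
        unfolding F_def using e B'(1) by (intro image_eqI[of _ _ "e ` {..n}"]) auto
      show ?thesis
      proof (rule h_lim[of c "\<lambda>n. \<Union>i\<le>n. e i"])
        show "eventually (\<lambda>n. z \<in> (\<Union>i\<le>n. e i) \<longleftrightarrow> z \<in> U) sequentially" for z
        proof (cases "z \<in> U")
          case True
          then obtain i where i: "z \<in> e i" using e B'(2) by blast
          show ?thesis using eventually_ge_at_top[of i] by eventually_elim (use i True in auto)
        next
          case False
          then show ?thesis using e B'(2) by (intro always_eventually) auto
        qed
      qed (use inF K_F F_open U in \<open>auto intro!: borel_open open_UN\<close>)
    qed
  qed
  have h_disj: "h c (A \<union> A') = h c A + h c A'"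
    if "A \<in> sets borel" "A' \<in> sets borel" "A \<inter> A' = {}" for c A A'
  proof -
    have "(\<lambda>z. c * indicator (A \<union> A') z) = (\<lambda>z. c * indicator A z + c * indicator A' z)"
      using that(3) by (auto simp: indicator_def fun_eq_iff)
    then show ?thesis using that by (simp add: h_def L2T_of_add h_L2)
  qed
  have K_borel: "\<forall>c. h c A \<in> K" if A: "A \<in> sets borel" for A
  proof -
    have "Int_stable {S :: complex set. open S}"
      by (auto simp: Int_stable_def)
    moreover have "{S :: complex set. open S} \<subseteq> Pow UNIV" by simp
    moreover have "A \<in> sigma_sets UNIV {S :: complex set. open S}"
      using A by (simp add: borel_def)
    ultimately show ?thesis
    proof (induction rule: sigma_sets_induct_disjoint)
      case (basic A)
      then show ?case using K_open by auto
    next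
      case empty
      show ?case using K_open[of "{}"] by auto
    next
      case (compl A)
      then have A: "A \<in> sets borel" by (simp add: borel_def)
      show ?case
      proof
        fix c :: complex
        have "(\<lambda>z. c * indicator (UNIV - A) z) = (\<lambda>z. c * indicator UNIV z + (- c) * indicator A z)"
          by (auto simp: indicator_def fun_eq_iff)
        then have "h c (UNIV - A) = h c UNIV + h (- c) A"
          unfolding h_def
          using L2T_of_add[OF h_L2[OF sets.top[of borel, unfolded space_borel], of c] h_L2[OF A, of "- c"]]
          by simp
        then show "h c (UNIV - A) \<in> K"
          using compl K_open[of UNIV c] K_add by auto
      qed
    next
      case (union A)
      then have A: "A i \<in> sets borel" for i by (auto simp: borel_def)
      have fin: "h c (\<Union>i<n. A i) \<in> K" for c n
      proof (induction n)
        case 0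
        show ?case using K_open[of "{}"] by auto
      next
        case (Suc n)
        have "(\<Union>i<n. A i) \<inter> A n = {}"
          using union(1) by (auto simp: disjoint_family_on_def) (metis UNIV_I disjoint_iff less_irrefl)
        then have "h c ((\<Union>i<n. A i) \<union> A n) = h c (\<Union>i<n. A i) + h c (A n)"
          using A by (intro h_disj) auto
        moreover have "(\<Union>i<Suc n. A i) = (\<Union>i<n. A i) \<union> A n"
          by (auto simp: less_Suc_eq)
        ultimately show ?case using Suc union(3) K_add by auto
      qed
      show ?case
      proof
        fix c :: complex
        show "h c (\<Union>i. A i) \<in> K"
        proof (rule h_lim[of c "\<lambda>n. \<Union>i<n. A i"])
          show "eventually (\<lambda>n. z \<in> (\<Union>i<n. A i) \<longleftrightarrow> z \<in> (\<Union>i. A i)) sequentially" for z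
          proof (cases "z \<in> (\<Union>i. A i)")
            case True
            then obtain i where i: "z \<in> A i" by blast
            show ?thesis using eventually_gt_at_top[of i] by eventually_elim (use i in auto)
          qed auto
        qed (use fin A in auto)
      qed
    qed
  qed
  have K_sum: "(\<lambda>z. \<Sum>c\<in>S. c * indicator (A c) z) \<in> L2_fun circle \<and>
      L2T_of (\<lambda>z. \<Sum>c\<in>S. c * indicator (A c) z) \<in> K"
    if "finite S" "\<And>c. c \<in> S \<Longrightarrow> A c \<in> sets borel" for S and A :: "complex \<Rightarrow> complex set"
    using that
  proof (induction S)
    case empty
    then show ?case using zero_K L2T_of_zero by (simp add: L2_fun_zero)
  next
    case (insert a S)
    then have A: "A a \<in> sets borel" by simp
    define t where "t = (\<lambda>z. \<Sum>c\<in>S. c * indicator (A c) z)"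
    have t: "t \<in> L2_fun circle" "L2T_of t \<in> K"
      using insert unfolding t_def by auto
    have eq: "(\<lambda>z. \<Sum>c\<in>insert a S. c * indicator (A c) z) = (\<lambda>z. a * indicator (A a) z + t z)"
      unfolding t_def using insert.hyps by (intro ext sum.insert)
    show ?case
      unfolding eq L2T_of_add[OF h_L2[OF A] t(1)]
      using L2_fun_add[OF h_L2[OF A] t(1)] K_add[OF K_borel[OF A, rule_format, unfolded h_def] t(2)]
      by simp
  qed
  have "x \<in> K" for x
  proof -
    obtain f where f: "f \<in> L2_fun circle" "x = L2T_of f" by (rule L2T_cases)
    have fm: "f \<in> borel_measurable circle" using f(1) by (rule L2_fun_measurable)
    obtain s where s: "\<And>n. simple_function circle (s n)" "\<And>z. (\<lambda>n. s n z) \<longlonglongrightarrow> f z"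
      "\<And>n z. cmod (s n z) \<le> 2 * cmod (f z)"
      using borel_measurable_implies_sequence_metric[OF fm, of 0] by auto
    have "(\<lambda>n. L2T_of (s n)) \<longlonglongrightarrow> L2T_of f"
    proof (rule L2T_of_dominated[where w="\<lambda>z. 2 * cmod (f z)"])
      show "integrable circle (\<lambda>z. (2 * cmod (f z))\<^sup>2)"
        using f(1) by (simp add: L2_fun_def power_mult_distrib)
    qed (use s fm in \<open>auto intro: borel_measurable_simple_function\<close>)
    moreover have "L2T_of (s n) \<in> K" for n
    proof -
      have eq: "s n = (\<lambda>z. \<Sum>c\<in>range (s n). c * indicator (s n -` {c}) z)"
      proof
        fix z
        have "s n z = (\<Sum>c\<in>range (s n). indicator (s n -` {c}) z *\<^sub>R c)"
          by (rule simple_function_indicator_representation_banach[OF s(1)[of n], of z,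
                unfolded space_circle Int_UNIV_right, OF UNIV_I])
        also have "\<dots> = (\<Sum>c\<in>range (s n). c * indicator (s n -` {c}) z)"
          by (intro sum.cong refl) (simp add: indicator_def)
        finally show "s n z = (\<Sum>c\<in>range (s n). c * indicator (s n -` {c}) z)" .
      qed
      have "s n -` {c} \<in> sets borel" for c
        using simple_functionD(2)[OF s(1)[of n], of "{c}"] by simp
      moreover have "finite (range (s n))"
        using simple_functionD(1)[OF s(1)[of n]] by simp
      ultimately have "L2T_of (\<lambda>z. \<Sum>c\<in>range (s n). c * indicator (s n -` {c}) z) \<in> K"
        using K_sum[of "range (s n)" "\<lambda>c. s n -` {c}"] by blast
      then show ?thesis by (rule ssubst[OF eq, where P="\<lambda>u. L2T_of u \<in> K"])
    qed
    ultimately show ?thesis using K_closed[of "\<lambda>n. L2T_of (s n)"] f(2) by blast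
  qed
  then show thesis
    using \<open>countable D\<close> that[of D] unfolding K_def by blast
qed

instance L2T :: second_countable_topology
proof
  obtain D :: "L2T set" where D: "countable D" "closure D = UNIV"
    by (rule L2T_countable_dense)
  define B where "B = (\<lambda>(d, n). ball d (1 / Suc n)) ` (D \<times> (UNIV :: nat set))"
  have "countable B"
    unfolding B_def using D by (intro countable_image countable_SIGMA) auto
  moreover have "topological_basis B"
  proof (rule topological_basisI)
    fix U and x :: L2T assume "open U" "x \<in> U"
    then obtain e where e: "e > 0" "ball x e \<subseteq> U"
      using open_contains_ball by blast
    obtain n where n: "1 / Suc n < e / 2"
      using nat_approx_posE[of "e / 2"] e(1) by auto
    have "x \<in> closure D" using D by simp
    then obtain d where d: "d \<in> D" "dist d x < 1 / Suc n"
      unfolding closure_approachable by (metis of_nat_0_less_iff zero_less_Suc zero_less_divide_1_iff)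
    have "ball d (1 / Suc n) \<subseteq> ball x e"
    proof
      fix y assume "y \<in> ball d (1 / Suc n)"
      then have "dist x y < 1 / Suc n + 1 / Suc n"
        using dist_triangle[of x y d] d(2) by (simp add: dist_commute)
      then show "y \<in> ball x e" using n by simp
    qed
    moreover have "x \<in> ball d (1 / Suc n)" using d by simp
    moreover have "ball d (1 / Suc n) \<in> B" unfolding B_def using d by auto
    ultimately show "\<exists>B'\<in>B. x \<in> B' \<and> B' \<subseteq> U" using e by blast
  qed (auto simp: B_def)
  ultimately show "\<exists>B :: L2T set set. countable B \<and> open = generate_topology B"
    using topological_basis_imp_subbasis by blast
qed

lift_definition L2_cinner :: "L2T \<Rightarrow> L2T \<Rightarrow> complex" is "\<lambda>f g. LINT z|circle. f z * cnj (g z)"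
proof -
  fix f f' g g' assume fg: "L2_eq f f'" "L2_eq g g'"
  have "AE z in circle. f z * cnj (g z) = f' z * cnj (g' z)"
    using fg unfolding L2_eq_def by (auto elim!: AE_mp)
  then show "(LINT z|circle. f z * cnj (g z)) = (LINT z|circle. f' z * cnj (g' z))"
    using fg[unfolded L2_eq_def]
    by (intro integral_cong_AE borel_measurable_integrable L2_fun_integrable_mult_cnj) auto
qed

section \<open>Fourier series, Hardy space and semigroup\<close>

text \<open>The factor \<open>2 * pi\<close> comes from the unnormalised arc length.\<close>

definition fourier_coeff :: "L2T \<Rightarrow> int \<Rightarrow> complex" where
  "fourier_coeff f n = L2_cinner f (L2T_of (\<lambda>z. z powi n)) / (2 * pi)"

text \<open>The series are sums in the norm of \<^typ>\<open>L2T\<close>; note that \<open>(cis x) powi n = cis (n * x)\<close>.\<close>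

definition riesz_proj :: "L2T \<Rightarrow> L2T" where
  "riesz_proj f = (\<Sum>\<^sub>\<infinity>n\<in>{0..}. L2T_of (\<lambda>z. fourier_coeff f n * z powi n))"

definition H2 :: "L2T set" where
  "H2 = range riesz_proj"

definition halfheat_semigroup :: "real \<Rightarrow> L2T \<Rightarrow> L2T" where
  "halfheat_semigroup t f =
    (\<Sum>\<^sub>\<infinity>n\<in>UNIV. L2T_of (\<lambda>z. fourier_coeff f n * exp (- \<bar>real_of_int n\<bar> * t) * z powi n))"

section \<open>The control system\<close>

definition control_measure :: "complex set \<Rightarrow> real \<Rightarrow> (real \<times> complex) measure" where
  "control_measure \<omega> T = restrict_space (lborel \<Otimes>\<^sub>M circle) ({0..T} \<times> \<omega>)"

definition extend_by_zero :: "complex set \<Rightarrow> (real \<times> complex \<Rightarrow> complex) \<Rightarrow> real \<Rightarrow> L2T" where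
  "extend_by_zero \<omega> u s = L2T_of (\<lambda>z. if z \<in> \<omega> then u (s, z) else 0)"

text \<open>The mild solution (Duhamel formula); the integral is the Bochner integral in \<^typ>\<open>L2T\<close>.\<close>

definition solution :: "complex set \<Rightarrow> (real \<times> complex \<Rightarrow> complex) \<Rightarrow> L2T \<Rightarrow> real \<Rightarrow> L2T" where
  "solution \<omega> u f0 T = halfheat_semigroup T f0 +
    (LINT s:{0..T}|lborel. halfheat_semigroup (T - s) (riesz_proj (extend_by_zero \<omega> u s)))"

definition steers_to_zero :: "complex set \<Rightarrow> real \<Rightarrow> (real \<times> complex \<Rightarrow> complex) \<Rightarrow> L2T \<Rightarrow> bool" where
  "steers_to_zero \<omega> T u f0 \<longleftrightarrow> solution \<omega> u f0 T = 0"

definition null_controllable :: "complex set \<Rightarrow> real \<Rightarrow> L2T set" where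
  "null_controllable \<omega> T =
    {f0 \<in> H2. \<exists>u \<in> L2_fun (control_measure \<omega> T). steers_to_zero \<omega> T u f0}"

definition bergman_norm :: "complex set \<Rightarrow> (complex \<Rightarrow> complex) \<Rightarrow> real" where
  "bergman_norm \<Omega> f = L2_norm (restrict_space lborel \<Omega>) f"

definition sector :: "complex set \<Rightarrow> real \<Rightarrow> complex set" where
  "sector \<omega> T = {z. 1 < cmod z \<and> cmod z < exp T \<and> z / of_real (cmod z) \<in> \<omega>}"

end

theory Submission
  imports Defs
begin

text \<open>
  The solution at time \<open>T\<close> lies in the closed span of the Fourier modes, so it vanishes iff all its
  Fourier coefficients do, and by the Duhamel formula this says that
  \<open>\<langle>f\<^sub>0, p\<rangle> = - \<integral>\<integral> u(s, w) * cnj (p (e\<^sup>s w))\<close> for all polynomials \<open>p\<close>. By the Riesz representation theorem on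
  the closure of the functions \<open>(s, w) \<mapsto> p (e\<^sup>s w)\<close> in \<open>L\<^sup>2([0,T] \<times> \<omega>)\<close>, such a \<open>u\<close> with norm at most \<open>K\<close>
  exists iff \<open>\<bar>\<langle>f\<^sub>0, p\<rangle>\<bar>\<close> is at most \<open>K\<close> times the norm of \<open>p (e\<^sup>s w)\<close>. Since \<open>dA = e\<^bsup>2s\<^esup> ds dw\<close> under
  \<open>z = e\<^sup>s w\<close>, that norm and the Bergman norm of \<open>p\<close> on the sector differ by a factor between
  \<open>1\<close> and \<open>e\<^sup>T\<close>.
\<close>

section \<open>Polar coordinates\<close>

text \<open>The substitution \<open>z = e^s w\<close> is forced by the Duhamel integrand. Its
  coefficient at \<open>n\<close> carries
  \<open>exp (- n * (T - s)) = exp (- n * T) * exp (n * s)\<close>: the first factor is a nonzero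
  constant and cancels from the equation "coefficient = 0", while the second turns
  \<open>w^n\<close> into \<open>(e^s w)^n\<close>. The Riesz projector removes
  \<open>n < 0\<close>, so \<open>|n| = n\<close> on everything that remains and the test functions
  are holomorphic monomials, hence polynomials by linear combination.

  The obstacle is that the functions \<open>p (e^s w)\<close> form a subspace of L2 that need not be
  closed, and that L2 of the control space is handled through representatives. The representation
  theorem is therefore stated for a linear image of an arbitrary group of parameters, here the
  polynomials. Its proof evaluates the functional at elements of that image only and reaches
  \<open>u\<close> by limits of inner products, so the functional is never extended to the
  closure.\<close>

lemma lborel_complex_eq:
  "(lborel :: complex measure) = distr (lborel \<Otimes>\<^sub>M lborel) borel (\<lambda>(x, y). Complex x y)"
proof (rule lborel_eqI)
  have meas: "(\<lambda>(x, y). Complex x y) \<in> borel_measurable (lborel \<Otimes>\<^sub>M lborel :: (real \<times> real) measure)"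
    unfolding Complex_eq split_beta by measurable
  fix l u :: complex
  assume "\<And>b. b \<in> Basis \<Longrightarrow> l \<bullet> b \<le> u \<bullet> b"
  from this[of 1] this[of \<i>] have le: "Re l \<le> Re u" "Im l \<le> Im u"
    by (auto simp: Basis_complex_def)
  have "emeasure (distr (lborel \<Otimes>\<^sub>M lborel) borel (\<lambda>(x, y). Complex x y)) (box l u)
      = emeasure (lborel \<Otimes>\<^sub>M lborel) ({Re l<..<Re u} \<times> {Im l<..<Im u})"
    by (subst emeasure_distr[OF meas])
      (auto intro!: arg_cong[where f="emeasure _"] simp: in_box_complex_iff space_pair_measure)
  also have "\<dots> = ennreal (Re u - Re l) * ennreal (Im u - Im l)"
    using le by (subst lborel.emeasure_pair_measure_Times) auto
  finally show "emeasure (distr (lborel \<Otimes>\<^sub>M lborel) borel (\<lambda>(x, y). Complex x y)) (box l u)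
      = (\<Prod>b\<in>Basis. (u - l) \<bullet> b)"
    using le by (simp add: Basis_complex_def ennreal_mult)
qed simp

lemma borel_measurable_Complex [measurable (raw)]:
  assumes [measurable]: "f \<in> borel_measurable M" "g \<in> borel_measurable M"
  shows "(\<lambda>x. Complex (f x) (g x)) \<in> borel_measurable M"
  unfolding Complex_eq by measurable

lemma borel_measurable_cis [measurable (raw)]:
  assumes "f \<in> borel_measurable M"
  shows "(\<lambda>x. cis (f x)) \<in> borel_measurable M"
  by (rule measurable_compose[OF assms borel_measurable_continuous_onI])
    (auto simp: cis_conv_exp intro!: continuous_intros)

lemma nn_integral_lborel_complex:
  assumes [measurable]: "f \<in> borel_measurable (borel :: complex measure)"
  shows "(\<integral>\<^sup>+z. f z \<partial>lborel) = (\<integral>\<^sup>+x. \<integral>\<^sup>+y. f (Complex x y) \<partial>lborel \<partial>lborel)"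
proof -
  have meas: "(\<lambda>(x, y). Complex x y) \<in> borel_measurable (lborel \<Otimes>\<^sub>M lborel :: (real \<times> real) measure)"
    by measurable
  have "(\<integral>\<^sup>+z. f z \<partial>lborel) = (\<integral>\<^sup>+q. f (case q of (x, y) \<Rightarrow> Complex x y) \<partial>(lborel \<Otimes>\<^sub>M lborel))"
    by (subst lborel_complex_eq, subst nn_integral_distr[OF meas]) auto
  also have "\<dots> = (\<integral>\<^sup>+x. \<integral>\<^sup>+y. f (Complex x y) \<partial>lborel \<partial>lborel)"
    by (subst lborel.nn_integral_fst[symmetric]) auto
  finally show ?thesis .
qed

text \<open>Lebesgue measure is the image under \<open>tan\<close> of the density
  \<open>1 / cos^2\<close> on \<open>(-pi/2, pi/2)\<close>: this density is the derivative of
  \<open>tan\<close>, so the preimage of \<open>(l, u)\<close> has mass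
  \<open>tan (arctan u) - tan (arctan l) = u - l\<close>, and boxes determine the measure.\<close>

lemma nn_integral_substitution_tan:
  assumes f [measurable]: "f \<in> borel_measurable (borel :: real measure)"
  shows "(\<integral>\<^sup>+t. f t \<partial>lborel) =
    (\<integral>\<^sup>+\<phi>. ennreal (1 / (cos \<phi>)\<^sup>2) * indicator {-pi/2<..<pi/2} \<phi> * f (tan \<phi>) \<partial>lborel)"
proof -
  define D where "D = density lborel (\<lambda>\<phi>. ennreal (1 / (cos \<phi>)\<^sup>2) * indicator {-pi/2<..<pi/2} \<phi>)"
  have [measurable]: "tan \<in> borel_measurable (borel :: real measure)"
    unfolding tan_def by measurable
  have tanD: "tan \<in> D \<rightarrow>\<^sub>M borel" unfolding D_def by simp
  have "lborel = distr D borel tan"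
  proof (rule lborel_eqI)
    fix l u :: real assume "\<And>b. b \<in> Basis \<Longrightarrow> l \<bullet> b \<le> u \<bullet> b"
    then have lu: "l \<le> u" by simp
    have "emeasure (distr D borel tan) (box l u) = emeasure D (tan -` {l<..<u})"
      by (subst emeasure_distr[OF tanD]) (auto simp: D_def box_real)
    also have "\<dots> = (\<integral>\<^sup>+\<phi>. ennreal (1 / (cos \<phi>)\<^sup>2) * indicator {-pi/2<..<pi/2} \<phi> * indicator (tan -` {l<..<u}) \<phi> \<partial>lborel)"
      unfolding D_def using measurable_sets_borel[of tan borel "{l<..<u}"]
      by (subst emeasure_density) auto
    \<comment> \<open>The fundamental theorem of calculus is applied on a compact interval. The
      preimage of \<open>(l, u)\<close> inside \<open>(-pi/2, pi/2)\<close> is its interior, so only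
      the two endpoints have to be discarded.\<close>
    also have "\<dots> = (\<integral>\<^sup>+\<phi>. ennreal (1 / (cos \<phi>)\<^sup>2) * indicator {arctan l..arctan u} \<phi> \<partial>lborel)"
    proof (rule nn_integral_cong_AE)
      show "AE \<phi> in lborel. ennreal (1 / (cos \<phi>)\<^sup>2) * indicator {-pi/2<..<pi/2} \<phi> * indicator (tan -` {l<..<u}) \<phi>
        = ennreal (1 / (cos \<phi>)\<^sup>2) * indicator {arctan l..arctan u} \<phi>"
        using AE_lborel_singleton[of "arctan l"] AE_lborel_singleton[of "arctan u"]
      proof eventually_elim
        case (elim \<phi>)
        have "\<phi> \<in> {-pi/2<..<pi/2} \<and> tan \<phi> \<in> {l<..<u} \<longleftrightarrow> \<phi> \<in> {arctan l..arctan u}"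
        proof
          assume a: "\<phi> \<in> {-pi/2<..<pi/2} \<and> tan \<phi> \<in> {l<..<u}"
          then have "arctan (tan \<phi>) = \<phi>" by (intro arctan_tan) auto
          then show "\<phi> \<in> {arctan l..arctan u}"
            using a by (metis arctan_le_iff atLeastAtMost_iff greaterThanLessThan_iff less_eq_real_def)
        next
          assume a: "\<phi> \<in> {arctan l..arctan u}"
          then have b: "arctan l < \<phi>" "\<phi> < arctan u" using elim by auto
          then have c: "-(pi/2) < \<phi>" "\<phi> < pi/2"
            using arctan_lbound[of l] arctan_ubound[of u] by auto
          then have "\<phi> = arctan (tan \<phi>)" by (simp add: arctan_tan)
          then show "\<phi> \<in> {-pi/2<..<pi/2} \<and> tan \<phi> \<in> {l<..<u}"
            using b c arctan_less_iff by (metis greaterThanLessThan_iff minus_divide_left)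
        qed
        then show ?case by (auto simp: indicator_def)
      qed
    qed
    also have "\<dots> = ennreal (tan (arctan u) - tan (arctan l))"
    proof (rule nn_integral_FTC_Icc)
      fix \<phi> assume "\<phi> \<in> {arctan l..arctan u}"
      then have "-(pi/2) < \<phi>" "\<phi> < pi/2"
        using arctan_lbound[of l] arctan_ubound[of u] by auto
      then have "cos \<phi> \<noteq> 0" using cos_gt_zero_pi[of \<phi>] by auto
      then show "(tan has_real_derivative 1 / (cos \<phi>)\<^sup>2) (at \<phi>)"
        by (auto intro!: derivative_eq_intros simp: field_simps)
    qed (use lu in \<open>auto simp: arctan_le_iff\<close>)
    finally show "emeasure (distr D borel tan) (box l u) = (\<Prod>b\<in>Basis. (u - l) \<bullet> b)"
      by (simp add: arctan)
  qed simp
  then have "(\<integral>\<^sup>+t. f t \<partial>lborel) = (\<integral>\<^sup>+t. f t \<partial>distr D borel tan)" by simp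
  also have "\<dots> = (\<integral>\<^sup>+\<phi>. f (tan \<phi>) \<partial>D)"
    by (rule nn_integral_distr[OF tanD]) simp
  also have "\<dots> = (\<integral>\<^sup>+\<phi>. ennreal (1 / (cos \<phi>)\<^sup>2) * indicator {-pi/2<..<pi/2} \<phi> * f (tan \<phi>) \<partial>lborel)"
    unfolding D_def by (rule nn_integral_density) auto
  finally show ?thesis .
qed

text \<open>Substitute \<open>y = t * x\<close>, then \<open>t = tan \<phi>\<close>, then \<open>x = r * cos \<phi>\<close>.\<close>

lemma nn_integral_polar_right_half:
  assumes f [measurable]: "f \<in> borel_measurable (borel :: complex measure)"
  shows "(\<integral>\<^sup>+z. f z * indicator {z. 0 < Re z} z \<partial>lborel) =
    (\<integral>\<^sup>+\<phi>. indicator {-pi/2<..<pi/2} \<phi> *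
      (\<integral>\<^sup>+r. ennreal r * f (of_real r * cis \<phi>) * indicator {0<..} r \<partial>lborel) \<partial>lborel)"
proof -
  have slope: "(\<integral>\<^sup>+y. f (Complex x y) * indicator {z. 0 < Re z} (Complex x y) \<partial>lborel) =
      (\<integral>\<^sup>+t. ennreal x * f (Complex x (t * x)) * indicator {0<..} x \<partial>lborel)" for x
  proof (cases "0 < x")
    case True
    have "(\<integral>\<^sup>+y. f (Complex x y) \<partial>lborel) = ennreal \<bar>x\<bar> * (\<integral>\<^sup>+t. f (Complex x (0 + x * t)) \<partial>lborel)"
      by (rule nn_integral_real_affine) (use True in auto)
    also have "\<dots> = (\<integral>\<^sup>+t. ennreal x * f (Complex x (t * x)) \<partial>lborel)"
      using True by (subst nn_integral_cmult[symmetric]) (auto simp: mult.commute)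
    finally show ?thesis using True by (auto simp: indicator_def)
  qed auto
  have "(\<integral>\<^sup>+z. f z * indicator {z. 0 < Re z} z \<partial>lborel)
      = (\<integral>\<^sup>+x. \<integral>\<^sup>+t. ennreal x * f (Complex x (t * x)) * indicator {0<..} x \<partial>lborel \<partial>lborel)"
    by (subst nn_integral_lborel_complex) (auto simp: slope)
  also have "\<dots> = (\<integral>\<^sup>+t. \<integral>\<^sup>+x. ennreal x * f (Complex x (t * x)) * indicator {0<..} x \<partial>lborel \<partial>lborel)"
    by (rule lborel_pair.Fubini') measurable
  also have "\<dots> = (\<integral>\<^sup>+\<phi>. ennreal (1 / (cos \<phi>)\<^sup>2) * indicator {-pi/2<..<pi/2} \<phi> *
      (\<integral>\<^sup>+x. ennreal x * f (Complex x (tan \<phi> * x)) * indicator {0<..} x \<partial>lborel) \<partial>lborel)"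
    by (rule nn_integral_substitution_tan) measurable
  also have "\<dots> = (\<integral>\<^sup>+\<phi>. indicator {-pi/2<..<pi/2} \<phi> *
      (\<integral>\<^sup>+r. ennreal r * f (of_real r * cis \<phi>) * indicator {0<..} r \<partial>lborel) \<partial>lborel)"
  proof (rule nn_integral_cong)
    fix \<phi> :: real
    show "ennreal (1 / (cos \<phi>)\<^sup>2) * indicator {-pi/2<..<pi/2} \<phi> *
      (\<integral>\<^sup>+x. ennreal x * f (Complex x (tan \<phi> * x)) * indicator {0<..} x \<partial>lborel) =
      indicator {-pi/2<..<pi/2} \<phi> *
      (\<integral>\<^sup>+r. ennreal r * f (of_real r * cis \<phi>) * indicator {0<..} r \<partial>lborel)"
    proof (cases "\<phi> \<in> {-pi/2<..<pi/2}")
      case True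
      then have c: "0 < cos \<phi>" by (intro cos_gt_zero_pi) auto
      have "(\<integral>\<^sup>+x. ennreal x * f (Complex x (tan \<phi> * x)) * indicator {0<..} x \<partial>lborel) =
        ennreal \<bar>cos \<phi>\<bar> * (\<integral>\<^sup>+r. ennreal (0 + cos \<phi> * r) * f (Complex (0 + cos \<phi> * r) (tan \<phi> * (0 + cos \<phi> * r)))
          * indicator {0<..} (0 + cos \<phi> * r) \<partial>lborel)"
        by (rule nn_integral_real_affine) (use c in auto)
      \<comment> \<open>One factor \<open>cos \<phi>\<close> comes from
        \<open>dx = cos \<phi> dr\<close>, the other from the weight
        \<open>x = r * cos \<phi>\<close>. Together they cancel the \<open>1 / cos^2\<close> left by
        the \<open>tan\<close> substitution.\<close>
      also have "\<dots> = ennreal \<bar>cos \<phi>\<bar> * (\<integral>\<^sup>+r. ennreal (cos \<phi>) * (ennreal r * f (of_real r * cis \<phi>) * indicator {0<..} r) \<partial>lborel)"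
      proof (intro arg_cong[where f="\<lambda>x. _ * x"] nn_integral_cong)
        fix r :: real
        have "Complex (0 + cos \<phi> * r) (tan \<phi> * (0 + cos \<phi> * r)) = of_real r * cis \<phi>"
          using c by (simp add: complex_eq_iff tan_def)
        then show "ennreal (0 + cos \<phi> * r) * f (Complex (0 + cos \<phi> * r) (tan \<phi> * (0 + cos \<phi> * r))) * indicator {0<..} (0 + cos \<phi> * r)
          = ennreal (cos \<phi>) * (ennreal r * f (of_real r * cis \<phi>) * indicator {0<..} r)"
          using c by (auto simp: indicator_def zero_less_mult_iff ennreal_mult mult_ac)
      qed
      also have "\<dots> = ennreal \<bar>cos \<phi>\<bar> * (ennreal (cos \<phi>) * (\<integral>\<^sup>+r. ennreal r * f (of_real r * cis \<phi>) * indicator {0<..} r \<partial>lborel))"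
        by (subst nn_integral_cmult) auto
      finally show ?thesis
        using c True by (simp add: mult.assoc[symmetric] ennreal_mult[symmetric] power2_eq_square)
    qed auto
  qed
  finally show ?thesis .
qed

section \<open>Arc length in terms of angles, and polar coordinates on the whole plane\<close>

lemma nn_integral_circle:
  assumes [measurable]: "h \<in> borel_measurable borel"
  shows "(\<integral>\<^sup>+w. h w \<partial>circle) = (\<integral>\<^sup>+\<theta>. h (cis \<theta>) * indicator {0..<2 * pi} \<theta> \<partial>lborel)"
  unfolding circle_def
  by (subst nn_integral_distr[OF cis_measurable_interval])
    (auto simp: nn_integral_restrict_space)

text \<open>Glues the half-plane formula to the full circle: the left half-plane is reached from the
  right one by \<open>z \<mapsto> - z\<close>, so both halves are parametrised by
  \<open>(-pi/2, pi/2)\<close>. Shifting the left half by \<open>pi\<close> and the negative angles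
  of the right half by \<open>2 * pi\<close> lands in \<open>[0, 2 * pi)\<close>; only the angles
  \<open>pi/2\<close> and \<open>3*pi/2\<close> are missed.\<close>

lemma nn_integral_circle_halves:
  assumes [measurable]: "h \<in> borel_measurable borel"
  shows "(\<integral>\<^sup>+w. h w \<partial>circle) =
    (\<integral>\<^sup>+\<phi>. indicator {-pi/2<..<pi/2} \<phi> * (h (cis \<phi>) + h (- cis \<phi>)) \<partial>lborel)"
proof -
  have left: "(\<integral>\<^sup>+\<phi>. indicator {-pi/2<..<pi/2} \<phi> * h (- cis \<phi>) \<partial>lborel)
      = (\<integral>\<^sup>+\<theta>. h (cis \<theta>) * indicator {pi/2<..<3*pi/2} \<theta> \<partial>lborel)"
    by (subst nn_integral_real_affine[where t="-pi" and c=1])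
      (auto intro!: nn_integral_cong simp: indicator_def cis_divide[symmetric] mult.commute)
  have "(\<integral>\<^sup>+\<phi>. indicator {-pi/2<..<pi/2} \<phi> * h (cis \<phi>) \<partial>lborel)
      = (\<integral>\<^sup>+\<phi>. h (cis \<phi>) * indicator {0..<pi/2} \<phi> + h (cis \<phi>) * indicator {-pi/2<..<0} \<phi> \<partial>lborel)"
    by (auto intro!: nn_integral_cong simp: indicator_def)
  also have "\<dots> = (\<integral>\<^sup>+\<phi>. h (cis \<phi>) * indicator {0..<pi/2} \<phi> \<partial>lborel)
      + (\<integral>\<^sup>+\<phi>. h (cis \<phi>) * indicator {-pi/2<..<0} \<phi> \<partial>lborel)"
    by (rule nn_integral_add) auto
  also have "(\<integral>\<^sup>+\<phi>. h (cis \<phi>) * indicator {-pi/2<..<0} \<phi> \<partial>lborel)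
      = (\<integral>\<^sup>+\<phi>. h (cis \<phi>) * indicator {3*pi/2<..<2*pi} \<phi> \<partial>lborel)"
    by (subst nn_integral_real_affine[where t="-2*pi" and c=1])
      (auto intro!: nn_integral_cong simp: indicator_def cis_divide[symmetric])
  finally have right: "(\<integral>\<^sup>+\<phi>. indicator {-pi/2<..<pi/2} \<phi> * h (cis \<phi>) \<partial>lborel)
      = (\<integral>\<^sup>+\<phi>. h (cis \<phi>) * indicator {0..<pi/2} \<phi> \<partial>lborel)
      + (\<integral>\<^sup>+\<phi>. h (cis \<phi>) * indicator {3*pi/2<..<2*pi} \<phi> \<partial>lborel)" .
  have "(\<integral>\<^sup>+\<phi>. indicator {-pi/2<..<pi/2} \<phi> * (h (cis \<phi>) + h (- cis \<phi>)) \<partial>lborel)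
      = (\<integral>\<^sup>+\<phi>. h (cis \<phi>) * indicator {0..<pi/2} \<phi> + h (cis \<phi>) * indicator {3*pi/2<..<2*pi} \<phi>
          + h (cis \<phi>) * indicator {pi/2<..<3*pi/2} \<phi> \<partial>lborel)"
    using left right by (simp add: distrib_left nn_integral_add)
  also have "\<dots> = (\<integral>\<^sup>+\<theta>. h (cis \<theta>) * indicator {0..<2 * pi} \<theta> \<partial>lborel)"
  proof (rule nn_integral_cong_AE)
    show "AE \<phi> in lborel. h (cis \<phi>) * indicator {0..<pi/2} \<phi> + h (cis \<phi>) * indicator {3*pi/2<..<2*pi} \<phi>
          + h (cis \<phi>) * indicator {pi/2<..<3*pi/2} \<phi> = h (cis \<phi>) * indicator {0..<2 * pi} \<phi>"
      using AE_lborel_singleton[of "pi/2"] AE_lborel_singleton[of "3*pi/2"]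
      by eventually_elim (use pi_gt_zero in \<open>auto simp: indicator_def\<close>)
  qed
  finally show ?thesis by (simp add: nn_integral_circle)
qed

text \<open>The imaginary axis is a null set, so the plane splits into the right half-plane and its
  reflection through 0. The last exchange of integrals puts the radius outside, which is the order
  required for substituting \<open>r = e^s\<close> later.\<close>

lemma nn_integral_polar:
  assumes f [measurable]: "f \<in> borel_measurable (borel :: complex measure)"
  shows "(\<integral>\<^sup>+z. f z \<partial>lborel) =
    (\<integral>\<^sup>+r. ennreal r * (\<integral>\<^sup>+w. f (of_real r * w) \<partial>circle) * indicator {0<..} r \<partial>lborel)"
proof -
  let ?I = "\<lambda>\<phi>::real. indicator {-pi/2<..<pi/2} \<phi> :: ennreal"
  let ?J = "\<lambda>r::real. indicator {0<..} r :: ennreal"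
  have im: "AE z in lborel. Re z \<noteq> (0::real)"
  proof -
    have "(\<integral>\<^sup>+z. indicator {z. Re z = 0} z \<partial>lborel) =
        (\<integral>\<^sup>+x. \<integral>\<^sup>+y. indicator {z. Re z = 0} (Complex x y) \<partial>lborel \<partial>lborel)"
      by (rule nn_integral_lborel_complex) measurable
    also have "\<dots> = (\<integral>\<^sup>+(x::real). 0 \<partial>lborel)"
    proof (rule nn_integral_cong_AE)
      show "AE x in lborel. (\<integral>\<^sup>+y. indicator {z. Re z = 0} (Complex x y) \<partial>lborel) = 0"
        using AE_lborel_singleton[of "0::real"] by eventually_elim auto
    qed
    finally have "emeasure lborel {z. Re z = 0} = 0" by simp
    then show ?thesis
      by (subst AE_iff_measurable[OF _ refl]) auto
  qed
  have neg: "(\<integral>\<^sup>+z. g (- z) \<partial>lborel) = (\<integral>\<^sup>+z. g z \<partial>lborel)" if [measurable]: "g \<in> borel_measurable borel" for g :: "complex \<Rightarrow> ennreal"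
  proof -
    have "(\<integral>\<^sup>+z. g z \<partial>lborel) = (\<integral>\<^sup>+x. \<integral>\<^sup>+y. g (Complex x y) \<partial>lborel \<partial>lborel)"
      by (rule nn_integral_lborel_complex) fact
    also have "\<dots> = (\<integral>\<^sup>+x. \<integral>\<^sup>+y. g (Complex (- x) y) \<partial>lborel \<partial>lborel)"
      by (subst nn_integral_real_affine[where t=0 and c="-1"]) auto
    also have "\<dots> = (\<integral>\<^sup>+x. \<integral>\<^sup>+y. g (Complex (- x) (- y)) \<partial>lborel \<partial>lborel)"
      by (rule nn_integral_cong, subst nn_integral_real_affine[where t=0 and c="-1"]) auto
    also have "\<dots> = (\<integral>\<^sup>+z. g (- z) \<partial>lborel)"
      by (subst nn_integral_lborel_complex) (auto simp: uminus_complex.code)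
    finally show ?thesis by simp
  qed
  have "(\<integral>\<^sup>+z. f z \<partial>lborel) =
      (\<integral>\<^sup>+z. f z * indicator {z. 0 < Re z} z + f z * indicator {z. 0 < Re z} (- z) \<partial>lborel)"
    by (rule nn_integral_cong_AE) (use im in eventually_elim, auto simp: indicator_def)
  also have "\<dots> = (\<integral>\<^sup>+z. f z * indicator {z. 0 < Re z} z \<partial>lborel)
      + (\<integral>\<^sup>+z. f (- (- z)) * indicator {z. 0 < Re z} (- z) \<partial>lborel)"
    by (subst nn_integral_add) auto
  also have "(\<integral>\<^sup>+z. f (- (- z)) * indicator {z. 0 < Re z} (- z) \<partial>lborel)
      = (\<integral>\<^sup>+z. f (- z) * indicator {z. 0 < Re z} z \<partial>lborel)"
    by (rule neg) measurable
  also have "(\<integral>\<^sup>+z. f z * indicator {z. 0 < Re z} z \<partial>lborel) + (\<integral>\<^sup>+z. f (- z) * indicator {z. 0 < Re z} z \<partial>lborel)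
      = (\<integral>\<^sup>+\<phi>. ?I \<phi> * (\<integral>\<^sup>+r. ennreal r * f (of_real r * cis \<phi>) * ?J r \<partial>lborel) \<partial>lborel)
      + (\<integral>\<^sup>+\<phi>. ?I \<phi> * (\<integral>\<^sup>+r. ennreal r * f (- (of_real r * cis \<phi>)) * ?J r \<partial>lborel) \<partial>lborel)"
    by (subst (1 2) nn_integral_polar_right_half) auto
  also have "\<dots> = (\<integral>\<^sup>+\<phi>. \<integral>\<^sup>+r. ennreal r * ?J r * (?I \<phi> * (f (of_real r * cis \<phi>) + f (of_real r * - cis \<phi>))) \<partial>lborel \<partial>lborel)"
    by (simp add: nn_integral_add[symmetric] nn_integral_cmult[symmetric] ring_distribs mult_ac)
  also have "\<dots> = (\<integral>\<^sup>+r. \<integral>\<^sup>+\<phi>. ennreal r * ?J r * (?I \<phi> * (f (of_real r * cis \<phi>) + f (of_real r * - cis \<phi>))) \<partial>lborel \<partial>lborel)"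
    by (rule lborel_pair.Fubini') measurable
  also have "\<dots> = (\<integral>\<^sup>+r. ennreal r * (\<integral>\<^sup>+w. f (of_real r * w) \<partial>circle) * ?J r \<partial>lborel)"
    by (intro nn_integral_cong, subst nn_integral_cmult, measurable,
        subst nn_integral_circle_halves[symmetric], measurable) (simp add: mult_ac)
  finally show ?thesis .
qed

section \<open>Riesz representation in \<open>L\<^sup>2\<close> of a finite measure\<close>

text \<open>Acts on representatives over an arbitrary measure, so that the same lemmas serve the
  circle and the control space; on the circle it computes \<open>L2_cinner\<close>.\<close>

definition L2_inner :: "'a measure \<Rightarrow> ('a \<Rightarrow> complex) \<Rightarrow> ('a \<Rightarrow> complex) \<Rightarrow> complex" where
  "L2_inner M f g = (LINT x|M. f x * cnj (g x))"

lemma L2_norm_nonneg: "0 \<le> L2_norm M f"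
  by (simp add: L2_norm_def)

lemma L2_norm_power2: "(L2_norm M f)\<^sup>2 = (LINT x|M. (cmod (f x))\<^sup>2)"
  by (simp add: L2_norm_def)

lemma L2_inner_add_left:
  "f \<in> L2_fun M \<Longrightarrow> g \<in> L2_fun M \<Longrightarrow> h \<in> L2_fun M \<Longrightarrow>
    L2_inner M (\<lambda>x. f x + g x) h = L2_inner M f h + L2_inner M g h"
  by (simp add: L2_inner_def ring_distribs L2_fun_integrable_mult_cnj)

lemma L2_inner_add_right:
  "f \<in> L2_fun M \<Longrightarrow> g \<in> L2_fun M \<Longrightarrow> h \<in> L2_fun M \<Longrightarrow>
    L2_inner M f (\<lambda>x. g x + h x) = L2_inner M f g + L2_inner M f h"
  by (simp add: L2_inner_def ring_distribs L2_fun_integrable_mult_cnj)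

lemma L2_inner_cmult_left: "L2_inner M (\<lambda>x. c * f x) h = c * L2_inner M f h"
  by (simp add: L2_inner_def mult.assoc)

lemma L2_inner_cmult_right: "L2_inner M f (\<lambda>x. c * h x) = cnj c * L2_inner M f h"
  by (simp add: L2_inner_def mult.left_commute)

lemma L2_inner_cnj: "L2_inner M g f = cnj (L2_inner M f g)"
proof -
  have "L2_inner M g f = (LINT x|M. cnj (f x * cnj (g x)))"
    by (simp add: L2_inner_def mult.commute)
  then show ?thesis by (simp only: L2_inner_def Bochner_Integration.integral_cnj)
qed

lemma L2_inner_self: "L2_inner M f f = of_real ((L2_norm M f)\<^sup>2)"
  by (simp only: L2_inner_def complex_norm_square[symmetric] integral_complex_of_real L2_norm_power2)

lemma L2_norm_cmult: "L2_norm M (\<lambda>x. c * f x) = cmod c * L2_norm M f"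
  by (simp add: L2_norm_def norm_mult power_mult_distrib real_sqrt_mult)

lemma L2_norm_add_power2:
  assumes f: "f \<in> L2_fun M" and g: "g \<in> L2_fun M"
  shows "(L2_norm M (\<lambda>x. f x + g x))\<^sup>2 = (L2_norm M f)\<^sup>2 + 2 * Re (L2_inner M f g) + (L2_norm M g)\<^sup>2"
proof -
  have "complex_of_real ((L2_norm M (\<lambda>x. f x + g x))\<^sup>2) =
      of_real ((L2_norm M f)\<^sup>2) + (L2_inner M f g + cnj (L2_inner M f g)) + of_real ((L2_norm M g)\<^sup>2)"
    unfolding L2_inner_self[symmetric]
    by (simp add: L2_inner_add_left L2_inner_add_right f g L2_fun_add L2_inner_cnj[of M g f])
  also have "\<dots> = of_real ((L2_norm M f)\<^sup>2 + 2 * Re (L2_inner M f g) + (L2_norm M g)\<^sup>2)"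
    by (simp add: complex_add_cnj)
  finally show ?thesis by (simp only: of_real_eq_iff)
qed

text \<open>Keeping the absolute values inside the integral also yields L1 bounds, by pairing with
  the constant 1; this is how completeness uses it.\<close>

lemma L2_Cauchy_Schwarz_abs:
  assumes f: "f \<in> L2_fun M" and g: "g \<in> L2_fun M"
  shows "(LINT x|M. cmod (f x) * cmod (g x)) \<le> L2_norm M f * L2_norm M g"
proof -
  note [measurable] = L2_fun_measurable[OF f] L2_fun_measurable[OF g]
  have int: "integrable M (\<lambda>x. cmod (f x) * cmod (g x))"
    using integrable_norm[OF L2_fun_integrable_mult_cnj[OF f g]] by (simp add: norm_mult)
  have sq: "(\<integral>\<^sup>+x. (ennreal (cmod (h x)))\<^sup>2 \<partial>M) = ennreal ((L2_norm M h)\<^sup>2)" if "h \<in> L2_fun M" for h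
    using that unfolding L2_norm_power2 L2_fun_def
    by (subst nn_integral_eq_integral[symmetric]) (auto simp: ennreal_power)
  have "ennreal ((LINT x|M. cmod (f x) * cmod (g x))\<^sup>2) = (\<integral>\<^sup>+x. ennreal (cmod (f x)) * ennreal (cmod (g x)) \<partial>M)\<^sup>2"
    by (subst ennreal_mult'[symmetric], simp, subst nn_integral_eq_integral[OF int]) (auto simp: ennreal_power)
  also have "\<dots> \<le> ennreal ((L2_norm M f)\<^sup>2) * ennreal ((L2_norm M g)\<^sup>2)"
    unfolding sq[OF f, symmetric] sq[OF g, symmetric] by (rule Cauchy_Schwarz_nn_integral) auto
  finally have "(LINT x|M. cmod (f x) * cmod (g x))\<^sup>2 \<le> (L2_norm M f * L2_norm M g)\<^sup>2"
    by (simp add: ennreal_mult'[symmetric] power_mult_distrib)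
  then show ?thesis
    by (rule power2_le_imp_le) (simp add: L2_norm_nonneg)
qed

lemma L2_Cauchy_Schwarz:
  assumes f: "f \<in> L2_fun M" and g: "g \<in> L2_fun M"
  shows "cmod (L2_inner M f g) \<le> L2_norm M f * L2_norm M g"
proof -
  have "cmod (L2_inner M f g) \<le> (LINT x|M. cmod (f x * cnj (g x)))"
    unfolding L2_inner_def by (rule integral_norm_bound)
  also have "\<dots> \<le> L2_norm M f * L2_norm M g"
    using L2_Cauchy_Schwarz_abs[OF f g] by (simp add: norm_mult)
  finally show ?thesis .
qed

lemma L2_norm_triangle:
  assumes f: "f \<in> L2_fun M" and g: "g \<in> L2_fun M"
  shows "L2_norm M (\<lambda>x. f x + g x) \<le> L2_norm M f + L2_norm M g"
proof (rule power2_le_imp_le)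
  have "Re (L2_inner M f g) \<le> L2_norm M f * L2_norm M g"
    using complex_Re_le_cmod L2_Cauchy_Schwarz[OF f g] by (rule order_trans)
  then show "(L2_norm M (\<lambda>x. f x + g x))\<^sup>2 \<le> (L2_norm M f + L2_norm M g)\<^sup>2"
    by (simp add: L2_norm_add_power2[OF f g] power2_sum)
qed (simp add: L2_norm_nonneg)

text \<open>Since the measure is finite, L2 bounds on the increments give L1 bounds. These are
  geometric, so the increments are absolutely summable almost everywhere and the sequence converges
  there. Fatou's lemma carries the L2 bound over to the limit.\<close>

lemma L2_complete_fast:
  fixes f :: "nat \<Rightarrow> 'a \<Rightarrow> complex"
  assumes M: "finite_measure M" and f: "\<And>k. f k \<in> L2_fun M"
    and fast: "\<And>k m n. k \<le> m \<Longrightarrow> k \<le> n \<Longrightarrow> L2_norm M (\<lambda>x. f m x - f n x) \<le> (1/2) ^ k"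
  obtains g where "g \<in> L2_fun M" "\<And>k. L2_norm M (\<lambda>x. f k x - g x) \<le> (1/2) ^ k"
proof -
  interpret finite_measure M by fact
  note [measurable] = L2_fun_measurable[OF f]
  define d where "d k x = cmod (f (Suc k) x - f k x)" for k x
  have one: "(\<lambda>_. 1) \<in> L2_fun M"
    by (rule L2_fun_bounded[OF M, of _ 1]) auto
  have d_int: "integrable M (d k)" and d_le: "(LINT x|M. d k x) \<le> (1/2) ^ k * L2_norm M (\<lambda>_. 1)" for k
  proof -
    have L2: "(\<lambda>x. f (Suc k) x - f k x) \<in> L2_fun M" by (intro L2_fun_diff f)
    show "integrable M (d k)"
      unfolding d_def using integrable_norm[OF L2_fun_integrable_mult_cnj[OF L2 one]] by simp
    have "(LINT x|M. d k x) \<le> L2_norm M (\<lambda>x. f (Suc k) x - f k x) * L2_norm M (\<lambda>_. 1)"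
      using L2_Cauchy_Schwarz_abs[OF L2 one] by (simp add: d_def)
    also have "\<dots> \<le> (1/2) ^ k * L2_norm M (\<lambda>_. 1)"
      by (intro mult_right_mono fast L2_norm_nonneg) auto
    finally show "(LINT x|M. d k x) \<le> (1/2) ^ k * L2_norm M (\<lambda>_. 1)" .
  qed
  have [measurable]: "d k \<in> borel_measurable M" for k using d_int by auto
  have "(\<integral>\<^sup>+x. (\<Sum>k. ennreal (d k x)) \<partial>M) = (\<Sum>k. \<integral>\<^sup>+x. ennreal (d k x) \<partial>M)"
    by (rule nn_integral_suminf) simp
  also have "\<dots> \<le> (\<Sum>k. ennreal ((1/2) ^ k * L2_norm M (\<lambda>_. 1)))"
  proof (rule suminf_le)
    show "(\<integral>\<^sup>+x. ennreal (d k x) \<partial>M) \<le> ennreal ((1/2) ^ k * L2_norm M (\<lambda>_. 1))" for k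
      by (subst nn_integral_eq_integral[OF d_int]) (auto intro!: ennreal_leI d_le simp: d_def)
  qed auto
  also have "\<dots> < \<infinity>"
    by (subst suminf_ennreal2) (auto simp: L2_norm_nonneg intro!: summable_mult2 summable_geometric)
  finally have "AE x in M. (\<Sum>k. ennreal (d k x)) \<noteq> \<infinity>"
    by (intro nn_integral_PInf_AE) auto
  then have lim: "AE x in M. (\<lambda>k. f k x) \<longlonglongrightarrow> lim (\<lambda>k. f k x)"
  proof eventually_elim
    case (elim x)
    then have "summable (\<lambda>k. d k x)"
      by (intro summable_suminf_not_top) (auto simp: d_def)
    then have "summable (\<lambda>k. f (Suc k) x - f k x)"
      unfolding d_def by (rule summable_norm_cancel)
    then have "convergent (\<lambda>n. f n x - f 0 x + f 0 x)"
      by (intro convergent_add convergent_const)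
        (simp add: summable_iff_convergent sum_lessThan_telescope[of "\<lambda>n. f n x"])
    then show ?case by (simp add: convergent_LIMSEQ_iff)
  qed
  define g where "g x = lim (\<lambda>k. f k x)" for x
  have [measurable]: "g \<in> borel_measurable M"
    unfolding g_def[abs_def] by (rule borel_measurable_lim_metric) simp
  have bound: "(\<integral>\<^sup>+x. ennreal ((cmod (f k x - g x))\<^sup>2) \<partial>M) \<le> ennreal (((1/2) ^ k)\<^sup>2)" for k
  proof -
    have "(\<integral>\<^sup>+x. ennreal ((cmod (f k x - g x))\<^sup>2) \<partial>M)
        = (\<integral>\<^sup>+x. liminf (\<lambda>n. ennreal ((cmod (f k x - f n x))\<^sup>2)) \<partial>M)"
      by (rule nn_integral_cong_AE, use lim in eventually_elim)
        (auto intro!: lim_imp_Liminf[symmetric] tendsto_intros simp: g_def)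
    also have "\<dots> \<le> liminf (\<lambda>n. \<integral>\<^sup>+x. ennreal ((cmod (f k x - f n x))\<^sup>2) \<partial>M)"
      by (rule nn_integral_liminf) simp
    also have "\<dots> \<le> ennreal (((1/2) ^ k)\<^sup>2)"
    proof (rule Liminf_le)
      have "(\<integral>\<^sup>+x. ennreal ((cmod (f k x - f n x))\<^sup>2) \<partial>M) \<le> ennreal (((1/2) ^ k)\<^sup>2)" if "k \<le> n" for n
      proof -
        have "(\<lambda>x. f k x - f n x) \<in> L2_fun M" by (intro L2_fun_diff f)
        then have "(\<integral>\<^sup>+x. ennreal ((cmod (f k x - f n x))\<^sup>2) \<partial>M) = ennreal ((L2_norm M (\<lambda>x. f k x - f n x))\<^sup>2)"
          unfolding L2_norm_power2 by (intro nn_integral_eq_integral) (auto simp: L2_fun_def)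
        also have "\<dots> \<le> ennreal (((1/2) ^ k)\<^sup>2)"
          by (intro ennreal_leI power_mono fast L2_norm_nonneg) (use that in auto)
        finally show ?thesis .
      qed
      then show "eventually (\<lambda>n. (\<integral>\<^sup>+x. ennreal ((cmod (f k x - f n x))\<^sup>2) \<partial>M) \<le> ennreal (((1/2) ^ k)\<^sup>2)) sequentially"
        using eventually_ge_at_top[of k] by (rule eventually_mono[rotated])
    qed simp
    finally show ?thesis .
  qed
  have int_g: "integrable M (\<lambda>x. (cmod (f k x - g x))\<^sup>2)" for k
    by (rule integrableI_bounded) (use bound[of k] in \<open>auto intro: le_less_trans\<close>)
  then have "(\<lambda>x. f 0 x - g x) \<in> L2_fun M"
    by (simp add: L2_fun_def)
  from L2_fun_diff[OF f[of 0] this] have "g \<in> L2_fun M" by simp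
  moreover have "L2_norm M (\<lambda>x. f k x - g x) \<le> (1/2) ^ k" for k
  proof (rule power2_le_imp_le)
    show "(L2_norm M (\<lambda>x. f k x - g x))\<^sup>2 \<le> ((1/2) ^ k)\<^sup>2"
      using bound[of k] unfolding L2_norm_power2
      by (subst (asm) nn_integral_eq_integral[OF int_g]) auto
  qed simp
  ultimately show thesis by (rule that)
qed

text \<open>\<open>u\<close> is the limit of a minimising sequence of the functional
  \<open>\<parallel>E v\<parallel>\<^sup>2 - 2 * Re (\<phi> v)\<close>, which is bounded below by \<open>- K\<^sup>2\<close>; by the parallelogram law
  the images of such a sequence are Cauchy.\<close>

lemma L2_Riesz_subspace:
  fixes E :: "'v::ab_group_add \<Rightarrow> 'a \<Rightarrow> complex" and sc :: "complex \<Rightarrow> 'v \<Rightarrow> 'v"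
  assumes M: "finite_measure M" and E: "\<And>v. E v \<in> L2_fun M"
    and E_add: "\<And>v w x. E (v + w) x = E v x + E w x"
    and E_sc: "\<And>c v x. E (sc c v) x = c * E v x"
    and \<phi>_add: "\<And>v w. \<phi> (v + w) = \<phi> v + \<phi> w"
    and \<phi>_sc: "\<And>c v. \<phi> (sc c v) = cnj c * \<phi> v"
    and bound: "\<And>v. cmod (\<phi> v) \<le> K * L2_norm M (E v)"
    and "0 \<le> K"
  obtains u where "u \<in> L2_fun M" "L2_norm M u \<le> K" "\<And>v. L2_inner M u (E v) = \<phi> v"
proof -
  define J where "J v = (L2_norm M (E v))\<^sup>2 - 2 * Re (\<phi> v)" for v
  define m where "m = Inf (range J)"
  have E_add': "E (v + w) = (\<lambda>x. E v x + E w x)" and E_sc': "E (sc c v) = (\<lambda>x. c * E v x)" for v w c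
    using E_add E_sc by auto
  have J_lower: "- K\<^sup>2 \<le> J v" for v
  proof -
    have "Re (\<phi> v) \<le> K * L2_norm M (E v)"
      using complex_Re_le_cmod bound by (rule order_trans)
    then show ?thesis
      using sum_squares_bound[of K "L2_norm M (E v)"] by (simp add: J_def)
  qed
  have bdd: "bdd_below (range J)"
    using J_lower by (intro bdd_belowI2)
  have m_le: "m \<le> J v" for v
    unfolding m_def by (rule cInf_lower[OF _ bdd]) auto
  \<comment> \<open>The parallelogram estimate bounds the squared distance by twice the sum of two
    excesses over \<open>m\<close>. The gap of a quarter of \<open>((1/2) ^ k)\<^sup>2\<close>
    therefore produces exactly the rate \<open>(1/2) ^ k\<close> that
    \<open>L2_complete_fast\<close> expects.\<close>
  have "\<exists>v. J v < m + ((1/2) ^ k)\<^sup>2 / 4" for k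
    using cInf_lessD[of "range J" "m + ((1/2) ^ k)\<^sup>2 / 4"] unfolding m_def by auto
  then obtain v where v: "\<And>k. J (v k) < m + ((1/2) ^ k)\<^sup>2 / 4" by metis
  have J_expand: "J (w + sc c w') = J w + 2 * Re (cnj c * (L2_inner M (E w) (E w') - \<phi> w'))
      + (cmod c)\<^sup>2 * (L2_norm M (E w'))\<^sup>2" for w w' c
    unfolding J_def E_add'
    by (subst L2_norm_add_power2[OF E E])
      (simp add: E_sc' L2_inner_cmult_right L2_norm_cmult \<phi>_add \<phi>_sc power_mult_distrib algebra_simps)
  \<comment> \<open>With \<open>d\<close> mapped to \<open>E w - E w'\<close>, the expansion of
    \<open>J\<close> around \<open>w'\<close> is compared at the full step, which has the value
    \<open>J w\<close>, and at the midpoint, where \<open>J\<close> is at least \<open>m\<close>.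
    Eliminating the linear term leaves the squared norm.\<close>
  have parallelogram: "(L2_norm M (\<lambda>x. E w x - E w' x))\<^sup>2 \<le> 2 * (J w - m) + 2 * (J w' - m)" for w w'
  proof -
    define d where "d = w + sc (-1) w'"
    have d: "E d = (\<lambda>x. E w x - E w' x)" by (simp add: d_def E_add' E_sc')
    \<comment> \<open>\<open>sc\<close> is tied to scalar multiplication only through
      \<open>E\<close> and \<open>\<phi>\<close>, so \<open>w' + sc 1 d\<close> need not be
      \<open>w\<close> itself. It has the same image, and \<open>J\<close> depends on the image
      alone because \<open>bound\<close> makes \<open>\<phi>\<close> vanish wherever
      \<open>E\<close> does.\<close>
    have J_cong: "J a = J b" if "E a = E b" for a b
    proof -
      have "E (a + sc (-1) b) = (\<lambda>x. 0)" using that by (simp add: E_add' E_sc')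
      then have "cmod (\<phi> (a + sc (-1) b)) \<le> 0"
        using bound[of "a + sc (-1) b"] by (simp add: L2_norm_def)
      then have "\<phi> a = \<phi> b" by (simp add: \<phi>_add \<phi>_sc)
      then show ?thesis using that by (simp add: J_def)
    qed
    have 1: "J w = J (w' + sc 1 d)"
      by (rule J_cong) (simp add: d E_add' E_sc')
    have "m \<le> J (w' + sc (1/2) d)" by (rule m_le)
    then show ?thesis
      unfolding 1 J_expand d[symmetric] by (simp add: power2_eq_square field_simps)
  qed
  have "L2_norm M (\<lambda>x. E (v i) x - E (v j) x) \<le> (1/2) ^ k" if "k \<le> i" "k \<le> j" for k i j
  proof (rule power2_le_imp_le)
    have dec: "((1/2::real) ^ i)\<^sup>2 \<le> ((1/2) ^ k)\<^sup>2" if "k \<le> i" for i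
      using that by (intro power_mono power_decreasing) auto
    have aux: "x \<le> r" if "x \<le> 2 * (a - m) + 2 * (b - m)" "a < m + p / 4" "b < m + q / 4" "p \<le> r" "q \<le> r"
      for a b p q r x :: real
      using that by (simp add: field_simps)
    show "(L2_norm M (\<lambda>x. E (v i) x - E (v j) x))\<^sup>2 \<le> ((1/2) ^ k)\<^sup>2"
      by (rule aux[OF parallelogram v v dec dec]) (use that in auto)
  qed simp
  then obtain u where u: "u \<in> L2_fun M" "\<And>k. L2_norm M (\<lambda>x. E (v k) x - u x) \<le> (1/2) ^ k"
    using L2_complete_fast[OF M, of "\<lambda>k. E (v k)"] E by metis
  have half: "(\<lambda>k. (1/2::real) ^ k) \<longlonglongrightarrow> 0" by (rule LIMSEQ_realpow_zero) auto
  have inner_lim: "(\<lambda>k. L2_inner M (E (v k)) h) \<longlonglongrightarrow> L2_inner M u h" if h: "h \<in> L2_fun M" for h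
  proof (rule Lim_null_comparison[THEN LIM_zero_cancel])
    show "(\<lambda>k. (1/2) ^ k * L2_norm M h) \<longlonglongrightarrow> 0"
      using tendsto_mult_left_zero[OF half] .
    have "norm (L2_inner M (E (v k)) h - L2_inner M u h) \<le> (1/2) ^ k * L2_norm M h" for k
    proof -
      have "L2_inner M (E (v k)) h - L2_inner M u h = L2_inner M (\<lambda>x. E (v k) x - u x) h"
        using L2_inner_add_left[OF L2_fun_diff[OF E u(1)] u(1) h, of "v k"] by simp
      also have "cmod \<dots> \<le> L2_norm M (\<lambda>x. E (v k) x - u x) * L2_norm M h"
        by (rule L2_Cauchy_Schwarz[OF L2_fun_diff[OF E u(1)] h])
      also have "\<dots> \<le> (1/2) ^ k * L2_norm M h"
        by (intro mult_right_mono u L2_norm_nonneg)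
      finally show ?thesis .
    qed
    then show "\<forall>\<^sub>F k in sequentially. norm (L2_inner M (E (v k)) h - L2_inner M u h) \<le> (1/2) ^ k * L2_norm M h"
      by simp
  qed
  \<comment> \<open>First-order condition at the limit: \<open>J (v k + sc c w)\<close> is at least
    \<open>m\<close> while \<open>J (v k)\<close> exceeds \<open>m\<close> by less than a vanishing
    gap. Only the inner product depends on \<open>k\<close> in the remaining terms, so the limit can
    be taken although \<open>u\<close> need not lie in the range of \<open>E\<close>.\<close>
  have stationary: "0 \<le> 2 * Re (cnj c * (L2_inner M u (E w) - \<phi> w)) + (cmod c)\<^sup>2 * (L2_norm M (E w))\<^sup>2" for c w
  proof (rule LIMSEQ_le_const)
    show "(\<lambda>k. ((1/2) ^ k)\<^sup>2 / 4 + (2 * Re (cnj c * (L2_inner M (E (v k)) (E w) - \<phi> w)) + (cmod c)\<^sup>2 * (L2_norm M (E w))\<^sup>2))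
        \<longlonglongrightarrow> 2 * Re (cnj c * (L2_inner M u (E w) - \<phi> w)) + (cmod c)\<^sup>2 * (L2_norm M (E w))\<^sup>2"
      by (rule tendsto_eq_intros half inner_lim[OF E] refl | simp)+
    show "\<exists>N. \<forall>k\<ge>N. 0 \<le> ((1/2) ^ k)\<^sup>2 / 4 + (2 * Re (cnj c * (L2_inner M (E (v k)) (E w) - \<phi> w)) + (cmod c)\<^sup>2 * (L2_norm M (E w))\<^sup>2)"
      using m_le[of "v _ + sc c w"] v unfolding J_expand by (smt (verit))
  qed
  have eq: "L2_inner M u (E w) = \<phi> w" for w
  proof (rule ccontr)
    assume "L2_inner M u (E w) \<noteq> \<phi> w"
    define a where "a = L2_inner M u (E w) - \<phi> w"
    define q where "q = (L2_norm M (E w))\<^sup>2"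
    have a: "0 < (cmod a)\<^sup>2" using \<open>L2_inner M u (E w) \<noteq> \<phi> w\<close> by (simp add: a_def)
    have q: "0 \<le> q" by (simp add: q_def)
    \<comment> \<open>Moving by \<open>- t * a\<close> changes the quadratic to
      \<open>t * |a|^2 * (t * q - 2)\<close>, which is negative for any \<open>t > 0\<close> with
      \<open>t * q < 2\<close>. The 1 in the denominator takes care of \<open>q = 0\<close>.\<close>
    define t where "t = 1 / (1 + q)"
    have t: "0 < t" "t * q < 2" using q by (auto simp: t_def field_simps)
    have "Re (cnj (of_real (-t) * a) * a) = - t * (cmod a)\<^sup>2"
      unfolding cmod_power2 by (simp add: power2_eq_square algebra_simps)
    moreover have "cmod (of_real (-t) * a) = t * cmod a" using t by (simp add: norm_mult)
    ultimately have "0 \<le> 2 * (- t * (cmod a)\<^sup>2) + (t * cmod a)\<^sup>2 * q"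
      using stationary[of "of_real (-t) * a" w, folded a_def q_def] by metis
    also have "\<dots> = (t * (cmod a)\<^sup>2) * (t * q - 2)"
      by (simp add: power2_eq_square algebra_simps)
    also have "\<dots> < 0"
      using t a by (intro mult_pos_neg mult_pos_pos) auto
    finally show False by simp
  qed
  have "L2_norm M u \<le> K"
  proof -
    \<comment> \<open>The squared norm of \<open>u\<close> is the limit of
      \<open>|\<phi> (v k)|\<close>, each of which is at most \<open>K\<close> times the norm of
      \<open>E (v k)\<close>; those norms are controlled by that of \<open>u\<close> up to
      \<open>(1/2) ^ k\<close>.\<close>
    have le: "(L2_norm M u)\<^sup>2 \<le> K * L2_norm M u"
    proof (rule LIMSEQ_le)
      show "(\<lambda>k. cmod (L2_inner M (E (v k)) u)) \<longlonglongrightarrow> (L2_norm M u)\<^sup>2"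
        using tendsto_norm[OF inner_lim[OF u(1)]] by (simp add: L2_inner_self norm_power L2_norm_nonneg)
      show "(\<lambda>k. K * ((1/2) ^ k + L2_norm M u)) \<longlonglongrightarrow> K * L2_norm M u"
        by (rule tendsto_eq_intros half refl | simp)+
      have "cmod (L2_inner M (E (v k)) u) \<le> K * ((1/2) ^ k + L2_norm M u)" for k
      proof -
        have "cmod (L2_inner M (E (v k)) u) = cmod (\<phi> (v k))"
          using eq[of "v k"] L2_inner_cnj[of M "E (v k)" u] by simp
        also have "\<dots> \<le> K * L2_norm M (E (v k))" by (rule bound)
        also have "L2_norm M (E (v k)) \<le> L2_norm M (\<lambda>x. E (v k) x - u x) + L2_norm M u"
          using L2_norm_triangle[OF L2_fun_diff[OF E u(1)] u(1), of "v k"] by simp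
        also have "\<dots> \<le> (1/2) ^ k + L2_norm M u" using u(2) by simp
        finally show ?thesis using \<open>0 \<le> K\<close> by (simp add: mult_left_mono)
      qed
      then show "\<exists>N. \<forall>k\<ge>N. cmod (L2_inner M (E (v k)) u) \<le> K * ((1/2) ^ k + L2_norm M u)" by blast
    qed
    show ?thesis
    proof (cases "L2_norm M u = 0")
      case False
      then have "0 < L2_norm M u" using L2_norm_nonneg[of M u] by simp
      then show ?thesis using le by (simp add: power2_eq_square)
    qed (use \<open>0 \<le> K\<close> in simp)
  qed
  then show thesis using that u(1) eq by blast
qed

section \<open>Fourier multipliers on the circle\<close>

lemma AE_circle_norm: "AE w in circle. cmod w = 1"
  unfolding circle_def by (subst AE_distr_iff[OF cis_measurable_interval]) auto

lemma borel_measurable_power_int [measurable (raw)]: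
  fixes f :: "'a \<Rightarrow> complex"
  assumes [measurable]: "f \<in> borel_measurable M"
  shows "(\<lambda>x. f x powi n) \<in> borel_measurable M"
  by (cases "0 \<le> n") (simp_all add: power_int_def)

lemma borel_measurable_cnj [measurable (raw)]:
  assumes "f \<in> borel_measurable M"
  shows "(\<lambda>x. cnj (f x)) \<in> borel_measurable M"
  by (rule measurable_compose[OF assms borel_measurable_continuous_onI]) (intro continuous_intros)

text \<open>The bound is asked for on the unit circle only, where the measure is concentrated.
  Powers and nonconstant polynomials are unbounded on the plane, so \<open>L2_fun_bounded\<close>
  does not apply to them.\<close>

lemma L2_fun_circle_bounded:
  assumes [measurable]: "f \<in> borel_measurable borel" and B: "\<And>w. cmod w = 1 \<Longrightarrow> cmod (f w) \<le> B"
  shows "f \<in> L2_fun circle"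
proof -
  interpret finite_measure circle by (rule finite_measure_circle)
  have "integrable circle (\<lambda>w. (cmod (f w))\<^sup>2)"
    by (rule integrable_const_bound[where B="B\<^sup>2"])
      (use AE_circle_norm in eventually_elim, auto intro!: power_mono B)
  then show ?thesis by (simp add: L2_fun_def)
qed

lemma integral_circle:
  fixes h :: "complex \<Rightarrow> complex"
  assumes "h \<in> borel_measurable borel"
  shows "(LINT w|circle. h w) = (LINT \<theta>:{0..<2 * pi}|lborel. h (cis \<theta>))"
  unfolding circle_def set_lebesgue_integral_def
  by (subst integral_distr[OF cis_measurable_interval assms])
    (simp add: integral_restrict_space)

lemma integral_circle_powi:
  "(LINT w|circle. w powi n) = (if n = 0 then 2 * pi else 0)"
proof -
  have "(LINT w|circle. w powi n) = (LINT \<theta>|lborel. indicator {0..<2*pi} \<theta> *\<^sub>R cis (n * \<theta>))"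
    by (subst integral_circle) (simp_all add: set_lebesgue_integral_def cis_power_int)
  also have "\<dots> = (LINT \<theta>|lborel. indicator {0..2*pi} \<theta> *\<^sub>R cis (n * \<theta>))"
    by (rule integral_cong_AE, measurable, measurable, use AE_lborel_singleton[of "2*pi"] in eventually_elim)
      (auto simp: indicator_def)
  also have "\<dots> = (if n = 0 then 2 * pi else 0)"
  proof (cases "n = 0")
    case False
    define F where "F \<theta> = cis (n * \<theta>) / (\<i> * n)" for \<theta> :: real
    have "has_bochner_integral lborel (\<lambda>\<theta>. indicator {0..2*pi} \<theta> *\<^sub>R cis (n * \<theta>)) (F (2*pi) - F 0)"
    proof (rule has_bochner_integral_FTC_Icc)
      fix \<theta> :: real
      have "(F has_vector_derivative cis (n * \<theta>)) (at \<theta>)"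
        unfolding F_def cis_conv_exp of_real_mult of_real_of_int_eq
        by (rule has_vector_derivative_real_field)
          (use False in \<open>auto intro!: derivative_eq_intros simp: field_simps\<close>)
      then show "(F has_vector_derivative cis (n * \<theta>)) (at \<theta> within {0..2*pi})"
        by (rule has_vector_derivative_at_within)
    qed (auto simp: cis_conv_exp intro!: continuous_intros)
    moreover have "F (2*pi) = F 0"
      using cis_multiple_2pi[of "real_of_int n"] by (simp add: F_def mult.commute)
    ultimately show ?thesis using False by (simp add: has_bochner_integral_integral_eq)
  qed (simp add: scaleR_conv_of_real)
  finally show ?thesis .
qed

text \<open>The complex coefficient sits inside the class because \<open>L2T\<close> carries real
  scalar multiplication; complex multiples of \<open>z powi n\<close> are expressed by varying
  \<open>c\<close>.\<close>

definition fourier_mode :: "int \<Rightarrow> complex \<Rightarrow> L2T" where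
  "fourier_mode n c = L2T_of (\<lambda>z. c * z powi n)"

lemma L2_fun_mode: "(\<lambda>z. c * z powi n) \<in> L2_fun circle"
  by (rule L2_fun_circle_bounded[of _ "cmod c"]) (auto simp: norm_mult norm_power_int)

lemma L2_cinner_L2T_of:
  "f \<in> L2_fun circle \<Longrightarrow> g \<in> L2_fun circle \<Longrightarrow> L2_cinner (L2T_of f) (L2T_of g) = L2_inner circle f g"
  by (simp add: L2T_of_def L2_cinner.abs_eq L2_eq_def L2_inner_def)

lemma inner_L2T_eq: "inner f g = Re (L2_cinner f g)"
  by transfer simp

lemma L2T_of_scaleR: "f \<in> L2_fun circle \<Longrightarrow> L2T_of (\<lambda>z. r *\<^sub>R f z) = r *\<^sub>R L2T_of f"
  by (simp add: L2T_of_def scaleR_L2T.abs_eq L2_eq_def L2_fun_scaleR)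

lemma norm_L2_cinner_le: "cmod (L2_cinner f g) \<le> norm f * norm g"
proof -
  obtain f' where "f' \<in> L2_fun circle" "f = L2T_of f'" by (rule L2T_cases)
  moreover obtain g' where "g' \<in> L2_fun circle" "g = L2T_of g'" by (rule L2T_cases)
  ultimately show ?thesis by (simp add: L2_cinner_L2T_of norm_L2T_of L2_Cauchy_Schwarz)
qed

lemma bounded_linear_L2_cinner: "bounded_linear (\<lambda>f. L2_cinner f g)"
proof (rule bounded_linear_intro[of _ "norm g"])
  fix f1 f2 :: L2T and r :: real
  obtain h1 where h1: "h1 \<in> L2_fun circle" "f1 = L2T_of h1" by (rule L2T_cases)
  obtain h2 where h2: "h2 \<in> L2_fun circle" "f2 = L2T_of h2" by (rule L2T_cases)
  obtain k where k: "k \<in> L2_fun circle" "g = L2T_of k" by (rule L2T_cases)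
  show "L2_cinner (f1 + f2) g = L2_cinner f1 g + L2_cinner f2 g"
    using h1 h2 k by (simp add: L2T_of_add[symmetric] L2_cinner_L2T_of L2_fun_add L2_inner_add_left)
  show "L2_cinner (r *\<^sub>R f1) g = r *\<^sub>R L2_cinner f1 g"
    using h1 k L2_inner_cmult_left[of circle "of_real r" h1 k]
    by (simp add: L2T_of_scaleR[symmetric] L2_cinner_L2T_of L2_fun_cmult scaleR_conv_of_real)
qed (rule norm_L2_cinner_le)

section \<open>Fourier coefficients, orthogonality of the modes and Bessel's inequality\<close>

lemma bounded_linear_fourier_coeff: "bounded_linear (\<lambda>f. fourier_coeff f n)"
  unfolding fourier_coeff_def
  by (intro bounded_linear_compose[OF bounded_linear_divide bounded_linear_L2_cinner])

lemma L2_inner_mode: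
  "L2_inner circle (\<lambda>z. c * z powi m) (\<lambda>z. d * z powi n) = (if m = n then of_real (2 * pi) * (c * cnj d) else 0)"
proof -
  have "L2_inner circle (\<lambda>z. c * z powi m) (\<lambda>z. d * z powi n) = (LINT w|circle. c * cnj d * w powi (m - n))"
    unfolding L2_inner_def
  proof (rule integral_cong_AE)
    show "AE w in circle. c * w powi m * cnj (d * w powi n) = c * cnj d * w powi (m - n)"
      using AE_circle_norm
    proof eventually_elim
      case (elim w)
      then obtain \<theta> where "w = cis \<theta>"
        by (metis cis_Arg complex_sgn_def div_by_1 norm_zero scaleR_one sgn_eq zero_neq_one of_real_1)
      then show ?case
        by (simp add: cis_power_int cis_cnj cis_mult algebra_simps)
    qed
  qed measurable
  also have "\<dots> = (if m = n then of_real (2 * pi) * (c * cnj d) else 0)"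
    by (simp add: integral_circle_powi)
  finally show ?thesis .
qed

lemma fourier_coeff_mode: "fourier_coeff (fourier_mode m c) n = (if m = n then c else 0)"
  using L2_inner_mode[of c m 1 n] L2_fun_mode[of 1 n]
  by (simp add: fourier_coeff_def fourier_mode_def L2_cinner_L2T_of L2_fun_mode)

lemma inner_fourier_mode_mode: "inner (fourier_mode m c) (fourier_mode n d) = (if m = n then 2 * pi * Re (c * cnj d) else 0)"
  by (simp add: inner_L2T_eq fourier_mode_def L2_cinner_L2T_of L2_fun_mode L2_inner_mode algebra_simps)

lemma norm_fourier_mode: "(norm (fourier_mode n c))\<^sup>2 = 2 * pi * (cmod c)\<^sup>2"
  by (subst power2_norm_eq_inner, simp add: inner_fourier_mode_mode cmod_power2)
    (simp add: power2_eq_square)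

lemma inner_fourier_mode: "inner f (fourier_mode n c) = 2 * pi * Re (fourier_coeff f n * cnj c)"
proof -
  obtain h where h: "h \<in> L2_fun circle" "f = L2T_of h" by (rule L2T_cases)
  have "L2_cinner f (fourier_mode n c) = cnj c * L2_cinner f (L2T_of (\<lambda>z. z powi n))"
    using h L2_fun_mode[of 1 n] L2_fun_mode[of c n]
    by (simp add: fourier_mode_def L2_cinner_L2T_of L2_inner_cmult_right)
  then have "L2_cinner f (fourier_mode n c) = of_real (2 * pi) * (fourier_coeff f n * cnj c)"
    by (simp add: fourier_coeff_def)
  then show ?thesis by (simp only: inner_L2T_eq Re_complex_of_real times_complex.sel) simp
qed

lemma bounded_linear_fourier_mode: "bounded_linear (fourier_mode n)"
proof (rule bounded_linear_intro[of _ "sqrt (2 * pi)"])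
  fix c d :: complex and r :: real
  show "fourier_mode n (c + d) = fourier_mode n c + fourier_mode n d"
    by (simp add: fourier_mode_def L2T_of_add[symmetric] L2_fun_mode ring_distribs)
  show "fourier_mode n (r *\<^sub>R c) = r *\<^sub>R fourier_mode n c"
    by (simp add: fourier_mode_def L2T_of_scaleR[symmetric] L2_fun_mode)
  show "norm (fourier_mode n c) \<le> norm c * sqrt (2 * pi)"
    by (rule power2_le_imp_le) (simp_all add: norm_fourier_mode power_mult_distrib)
qed

lemma fourier_mode_zero [simp]: "fourier_mode n 0 = 0"
  by (rule bounded_linear.linear[OF bounded_linear_fourier_mode, THEN linear_0])

lemma norm_sum_fourier_mode:
  assumes "finite F"
  shows "(norm (\<Sum>n\<in>F. fourier_mode n (c n)))\<^sup>2 = (\<Sum>n\<in>F. 2 * pi * (cmod (c n))\<^sup>2)"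
proof -
  have "(norm (\<Sum>n\<in>F. fourier_mode n (c n)))\<^sup>2 = (\<Sum>n\<in>F. (norm (fourier_mode n (c n)))\<^sup>2)"
    by (rule norm_sum_Pythagorean[OF assms]) (auto simp: pairwise_def orthogonal_def inner_fourier_mode_mode)
  then show ?thesis by (simp add: norm_fourier_mode)
qed

lemma Bessel_inequality:
  assumes "finite F"
  shows "(\<Sum>n\<in>F. 2 * pi * (cmod (fourier_coeff f n))\<^sup>2) \<le> (norm f)\<^sup>2"
proof -
  define g where "g = (\<Sum>n\<in>F. fourier_mode n (fourier_coeff f n))"
  have g: "(norm g)\<^sup>2 = (\<Sum>n\<in>F. 2 * pi * (cmod (fourier_coeff f n))\<^sup>2)"
    unfolding g_def by (rule norm_sum_fourier_mode[OF assms])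
  have "inner f g = (\<Sum>n\<in>F. 2 * pi * (cmod (fourier_coeff f n))\<^sup>2)"
    unfolding g_def inner_sum_right inner_fourier_mode complex_norm_square[symmetric]
    by (simp only: Re_complex_of_real)
  then have "inner f g = (norm g)\<^sup>2" using g by simp
  moreover have "0 \<le> (norm (f - g))\<^sup>2" by simp
  ultimately have "(norm g)\<^sup>2 \<le> (norm f)\<^sup>2"
    by (simp add: power2_norm_eq_inner inner_diff_left inner_diff_right inner_commute)
  then show ?thesis using g by simp
qed

text \<open>Common form of the Riesz projector and the semigroup. \<open>infsum\<close> returns 0
  for families that are not summable; the condition \<open>cmod (a n) \<le> 1\<close> in the lemmas
  below ensures that the sum is a genuine one.\<close>

definition fourier_multiplier :: "(int \<Rightarrow> complex) \<Rightarrow> L2T \<Rightarrow> L2T" where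
  "fourier_multiplier a f = (\<Sum>\<^sub>\<infinity>n. fourier_mode n (a n * fourier_coeff f n))"

lemma norm_multiplier_partial_sum_le:
  assumes a: "\<And>n. cmod (a n) \<le> 1" and "finite F"
  shows "norm (\<Sum>n\<in>F. fourier_mode n (a n * fourier_coeff f n)) \<le> norm f"
proof (rule power2_le_imp_le)
  have "(norm (\<Sum>n\<in>F. fourier_mode n (a n * fourier_coeff f n)))\<^sup>2
      = (\<Sum>n\<in>F. 2 * pi * (cmod (a n * fourier_coeff f n))\<^sup>2)"
    by (rule norm_sum_fourier_mode[OF \<open>finite F\<close>])
  also have "\<dots> \<le> (\<Sum>n\<in>F. 2 * pi * (cmod (fourier_coeff f n))\<^sup>2)"
    by (intro sum_mono mult_left_mono power_mono) (auto simp: norm_mult intro!: mult_left_le_one_le a)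
  also have "\<dots> \<le> (norm f)\<^sup>2" by (rule Bessel_inequality[OF \<open>finite F\<close>])
  finally show "(norm (\<Sum>n\<in>F. fourier_mode n (a n * fourier_coeff f n)))\<^sup>2 \<le> (norm f)\<^sup>2" .
qed simp

text \<open>Square-summable coefficients need not give summable norms, so the Cauchy criterion is
  checked for unordered sums: by orthogonality the squared distance of two finite partial sums is
  the sum of \<open>q\<close> over the symmetric difference of their index sets.\<close>

lemma summable_on_fourier_mode:
  assumes sq: "(\<lambda>n. (cmod (c n))\<^sup>2) summable_on UNIV"
  shows "(\<lambda>n. fourier_mode n (c n)) summable_on UNIV"
proof -
  define f where "f n = fourier_mode n (c n)" for n
  define q where "q n = 2 * pi * (cmod (c n))\<^sup>2" for n
  have q0: "0 \<le> q n" for n by (simp add: q_def)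
  have "q summable_on UNIV"
    unfolding q_def[abs_def] by (rule summable_on_cmult_right[OF sq])
  then obtain L where L: "(sum q \<longlongrightarrow> L) (finite_subsets_at_top UNIV)"
    unfolding summable_on_def has_sum_def by blast
  have le: "(dist (sum f A) (sum f B))\<^sup>2 \<le> sum q (B - A) + sum q (A - B)" if "finite A" "finite B" for A B
  proof -
    \<comment> \<open>Flipping the sign on \<open>B - A\<close> writes the difference of the two
      partial sums as one sum of modes, to which Pythagoras applies.\<close>
    define d where "d n = (if n \<in> A then c n else - c n)" for n
    have minus: "fourier_mode n (- x) = - fourier_mode n x" for n x
      by (rule linear_neg[OF bounded_linear.linear[OF bounded_linear_fourier_mode]])
    have "sum f A - sum f B = sum f (A - B) - sum f (B - A)"
      using that sum.Int_Diff[of A f B] sum.Int_Diff[of B f A] by (simp add: Int_commute)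
    also have "\<dots> = sum (\<lambda>n. fourier_mode n (d n)) (A - B) + sum (\<lambda>n. fourier_mode n (d n)) (B - A)"
      by (simp add: f_def d_def minus sum_negf)
    also have "\<dots> = sum (\<lambda>n. fourier_mode n (d n)) ((A - B) \<union> (B - A))"
      using that by (intro sum.union_disjoint[symmetric]) auto
    finally have "(dist (sum f A) (sum f B))\<^sup>2 = (\<Sum>n\<in>(A - B) \<union> (B - A). 2 * pi * (cmod (d n))\<^sup>2)"
      using that by (simp add: dist_norm norm_sum_fourier_mode)
    also have "\<dots> = sum q ((A - B) \<union> (B - A))"
      by (intro sum.cong) (auto simp: q_def d_def)
    also have "\<dots> = sum q (B - A) + sum q (A - B)"
      using that by (subst sum.union_disjoint) auto
    finally show ?thesis by simp
  qed
  have "\<exists>P. eventually P (finite_subsets_at_top UNIV) \<and> (\<forall>A B. P A \<and> P B \<longrightarrow> dist (sum f A) (sum f B) < e)"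
    if "0 < e" for e
  proof -
    \<comment> \<open>The sum of \<open>q\<close> over the symmetric difference is twice the sum
      over \<open>A \<union> B\<close> minus those over \<open>A\<close> and \<open>B\<close>. This
      involves four deviations from \<open>L\<close>, each below \<open>e^2 / 4\<close>.\<close>
    define d where "d = e\<^sup>2 / 4"
    have d: "0 < d" "4 * d = e\<^sup>2" using that by (simp_all add: d_def)
    have "eventually (\<lambda>F. dist (sum q F) L < d) (finite_subsets_at_top UNIV)"
      by (rule tendstoD[OF L d(1)])
    then obtain X where X: "finite X" "\<And>F. finite F \<Longrightarrow> X \<subseteq> F \<Longrightarrow> dist (sum q F) L < d"
      unfolding eventually_finite_subsets_at_top by auto
    have "dist (sum f A) (sum f B) < e" if "finite A" "X \<subseteq> A" "finite B" "X \<subseteq> B" for A B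
    proof (rule power2_less_imp_less)
      have "sum q (A \<union> B) = sum q A + sum q (B - A)" "sum q (A \<union> B) = sum q B + sum q (A - B)"
        using that sum.union_disjoint[of A "B - A" q] sum.union_disjoint[of B "A - B" q]
        by (auto simp: Un_commute)
      moreover have "dist (sum q (A \<union> B)) L < d" "dist (sum q A) L < d" "dist (sum q B) L < d"
        using that by (blast intro: X(2))+
      ultimately have "sum q (B - A) + sum q (A - B) < e\<^sup>2"
        unfolding dist_real_def using d(2) by linarith
      then show "(dist (sum f A) (sum f B))\<^sup>2 < e\<^sup>2"
        using le[OF that(1,3)] by simp
    qed (use \<open>0 < e\<close> in simp)
    moreover have "eventually (\<lambda>A. finite A \<and> X \<subseteq> A) (finite_subsets_at_top UNIV)"
      unfolding eventually_finite_subsets_at_top using X(1) by blast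
    ultimately show ?thesis by blast
  qed
  then have "cauchy_filter (filtermap (sum f) (finite_subsets_at_top UNIV))"
    by (simp add: cauchy_filter_metric_filtermap)
  moreover have "complete (UNIV :: L2T set)"
    by (meson Cauchy_convergent UNIV_I complete_def convergent_def)
  ultimately obtain L' where "(sum f \<longlongrightarrow> L') (finite_subsets_at_top UNIV)"
    using complete_uniform[where S="UNIV :: L2T set"] by (force simp: filterlim_def)
  then show ?thesis
    unfolding f_def[abs_def] summable_on_def has_sum_def by blast
qed

lemma has_sum_fourier_multiplier:
  assumes a: "\<And>n. cmod (a n) \<le> 1"
  shows "((\<lambda>n. fourier_mode n (a n * fourier_coeff f n)) has_sum fourier_multiplier a f) UNIV"
proof -
  have "(\<lambda>n. (cmod (a n * fourier_coeff f n))\<^sup>2) summable_on UNIV"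
  proof (rule nonneg_bdd_above_summable_on)
    show "bdd_above (sum (\<lambda>n. (cmod (a n * fourier_coeff f n))\<^sup>2) ` {F. F \<subseteq> UNIV \<and> finite F})"
    proof (rule bdd_aboveI2[of _ _ "(norm f)\<^sup>2 / (2 * pi)"])
      fix F :: "int set" assume "F \<in> {F. F \<subseteq> UNIV \<and> finite F}"
      then have F: "finite F" by simp
      have "(\<Sum>n\<in>F. (cmod (a n * fourier_coeff f n))\<^sup>2) \<le> (\<Sum>n\<in>F. (cmod (fourier_coeff f n))\<^sup>2)"
        by (intro sum_mono power_mono) (auto simp: norm_mult intro!: mult_left_le_one_le a)
      also have "\<dots> \<le> (norm f)\<^sup>2 / (2 * pi)"
        using Bessel_inequality[OF F, of f] by (simp add: sum_distrib_left[symmetric] field_simps)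
      finally show "(\<Sum>n\<in>F. (cmod (a n * fourier_coeff f n))\<^sup>2) \<le> (norm f)\<^sup>2 / (2 * pi)" .
    qed
  qed simp
  from summable_on_fourier_mode[OF this] show ?thesis
    unfolding fourier_multiplier_def by (rule has_sum_infsum)
qed

lemma norm_fourier_multiplier_le:
  assumes a: "\<And>n. cmod (a n) \<le> 1"
  shows "norm (fourier_multiplier a f) \<le> norm f"
proof (rule tendsto_upperbound)
  show "((\<lambda>F. norm (\<Sum>n\<in>F. fourier_mode n (a n * fourier_coeff f n))) \<longlongrightarrow> norm (fourier_multiplier a f))
      (finite_subsets_at_top UNIV)"
    using has_sum_fourier_multiplier[OF a] unfolding has_sum_def by (rule tendsto_norm)
  show "\<forall>\<^sub>F F in finite_subsets_at_top UNIV. norm (\<Sum>n\<in>F. fourier_mode n (a n * fourier_coeff f n)) \<le> norm f"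
    by (rule eventually_finite_subsets_at_top_weakI) (rule norm_multiplier_partial_sum_le[OF a])
qed simp

lemma bounded_linear_fourier_multiplier:
  assumes a: "\<And>n. cmod (a n) \<le> 1"
  shows "bounded_linear (fourier_multiplier a)"
proof (rule bounded_linear_intro[of _ 1])
  fix f g :: L2T and r :: real
  note lin = bounded_linear.linear[OF bounded_linear_fourier_mode] bounded_linear.linear[OF bounded_linear_fourier_coeff]
  have "((\<lambda>n. fourier_mode n (a n * fourier_coeff f n) + fourier_mode n (a n * fourier_coeff g n)) has_sum
      (fourier_multiplier a f + fourier_multiplier a g)) UNIV"
    by (intro has_sum_add has_sum_fourier_multiplier a)
  moreover have "fourier_mode n (a n * fourier_coeff f n) + fourier_mode n (a n * fourier_coeff g n)
      = fourier_mode n (a n * fourier_coeff (f + g) n)" for n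
    by (simp add: linear_add[OF lin(1)] linear_add[OF lin(2)] ring_distribs)
  ultimately show "fourier_multiplier a (f + g) = fourier_multiplier a f + fourier_multiplier a g"
    using has_sum_fourier_multiplier[of a "f + g", OF a] by (simp add: has_sum_unique)
  have "((\<lambda>n. r *\<^sub>R fourier_mode n (a n * fourier_coeff f n)) has_sum (r *\<^sub>R fourier_multiplier a f)) UNIV"
    by (rule has_sum_bounded_linear[OF bounded_linear_scaleR_right has_sum_fourier_multiplier[OF a]])
  moreover have "r *\<^sub>R fourier_mode n (a n * fourier_coeff f n) = fourier_mode n (a n * fourier_coeff (r *\<^sub>R f) n)" for n
    by (simp add: linear_scale[OF lin(1), symmetric] linear_scale[OF lin(2)])
  ultimately show "fourier_multiplier a (r *\<^sub>R f) = r *\<^sub>R fourier_multiplier a f"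
    using has_sum_fourier_multiplier[of a "r *\<^sub>R f", OF a] by (simp add: has_sum_unique)
qed (simp add: norm_fourier_multiplier_le[OF a])

lemma fourier_coeff_multiplier:
  assumes a: "\<And>n. cmod (a n) \<le> 1"
  shows "fourier_coeff (fourier_multiplier a f) m = a m * fourier_coeff f m"
proof (rule has_sum_unique)
  show "((\<lambda>n. fourier_coeff (fourier_mode n (a n * fourier_coeff f n)) m) has_sum
      fourier_coeff (fourier_multiplier a f) m) UNIV"
    by (rule has_sum_bounded_linear[OF bounded_linear_fourier_coeff has_sum_fourier_multiplier[OF a]])
  have "((\<lambda>n. fourier_coeff (fourier_mode n (a n * fourier_coeff f n)) m) has_sum
      (\<Sum>n\<in>{m}. fourier_coeff (fourier_mode n (a n * fourier_coeff f n)) m)) {m}"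
    by (rule has_sum_finite) simp
  then show "((\<lambda>n. fourier_coeff (fourier_mode n (a n * fourier_coeff f n)) m) has_sum
      (a m * fourier_coeff f m)) UNIV"
    by (subst has_sum_cong_neutral[where T="{m}"]) (auto simp: fourier_coeff_mode)
qed

lemma fourier_multiplier_compose:
  assumes "\<And>n. cmod (b n) \<le> 1"
  shows "fourier_multiplier a (fourier_multiplier b f) = fourier_multiplier (\<lambda>n. a n * b n) f"
  by (simp add: fourier_multiplier_def[of a] fourier_multiplier_def[of "\<lambda>n. a n * b n"]
      fourier_coeff_multiplier[OF assms] mult.assoc)

lemma riesz_proj_eq_multiplier: "riesz_proj = fourier_multiplier (\<lambda>n. if 0 \<le> n then 1 else 0)"
  unfolding riesz_proj_def[abs_def] fourier_multiplier_def[abs_def] fourier_mode_def[symmetric]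
  by (intro ext infsum_cong_neutral) auto

lemma halfheat_semigroup_eq_multiplier:
  "halfheat_semigroup t = fourier_multiplier (\<lambda>n. of_real (exp (- \<bar>real_of_int n\<bar> * t)))"
  unfolding halfheat_semigroup_def[abs_def] fourier_multiplier_def[abs_def] fourier_mode_def[symmetric]
  by (simp add: mult.commute)

lemma fourier_coeff_H2_neg:
  assumes "f \<in> H2" "n < 0" shows "fourier_coeff f n = 0"
  using assms by (auto simp: H2_def riesz_proj_eq_multiplier fourier_coeff_multiplier)

section \<open>The Bergman norm in logarithmic polar coordinates\<close>

lemma sigma_finite_circle: "sigma_finite_measure circle"
  by (rule finite_measure.axioms(1)[OF finite_measure_circle])

lemma sets_cylinder: "\<omega> \<in> sets borel \<Longrightarrow> {0..T::real} \<times> \<omega> \<in> sets (lborel \<Otimes>\<^sub>M circle)"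
  by (intro pair_measureI) auto

lemma nn_integral_control_measure:
  assumes \<omega>: "\<omega> \<in> sets borel" and f [measurable]: "f \<in> borel_measurable (borel \<Otimes>\<^sub>M borel)"
  shows "(\<integral>\<^sup>+x. f x \<partial>control_measure \<omega> T) =
    (\<integral>\<^sup>+s. (\<integral>\<^sup>+w. f (s, w) * indicator \<omega> w \<partial>circle) * indicator {0..T} s \<partial>lborel)"
proof -
  interpret sigma_finite_measure circle by (rule sigma_finite_circle)
  note [measurable] = \<omega>
  have m: "f \<in> borel_measurable (lborel \<Otimes>\<^sub>M circle)"
    by (subst measurable_cong_sets[OF sets_pair_measure_cong[of _ borel _ borel] refl]) auto
  have "(\<integral>\<^sup>+x. f x \<partial>control_measure \<omega> T) = (\<integral>\<^sup>+x. f x * indicator ({0..T} \<times> \<omega>) x \<partial>(lborel \<Otimes>\<^sub>M circle))"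
    unfolding control_measure_def using sets_cylinder[OF \<omega>, of T]
    by (subst nn_integral_restrict_space) (auto simp: space_pair_measure)
  also have "\<dots> = (\<integral>\<^sup>+s. \<integral>\<^sup>+w. f (s, w) * indicator ({0..T} \<times> \<omega>) (s, w) \<partial>circle \<partial>lborel)"
    by (rule nn_integral_fst[symmetric]) (use m sets_cylinder[OF \<omega>, of T] in measurable)
  also have "\<dots> = (\<integral>\<^sup>+s. (\<integral>\<^sup>+w. f (s, w) * indicator \<omega> w \<partial>circle) * indicator {0..T} s \<partial>lborel)"
    by (intro nn_integral_cong) (auto simp: indicator_times indicator_def intro!: nn_integral_cong)
  finally show ?thesis .
qed

lemma finite_measure_control:
  assumes \<omega>: "\<omega> \<in> sets borel"
  shows "finite_measure (control_measure \<omega> T)"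
proof
  interpret C: finite_measure circle by (rule finite_measure_circle)
  have "emeasure (control_measure \<omega> T) (space (control_measure \<omega> T)) = emeasure (lborel \<Otimes>\<^sub>M circle) ({0..T} \<times> \<omega>)"
    unfolding control_measure_def using sets_cylinder[OF \<omega>, of T]
    by (subst emeasure_restrict_space) (auto simp: space_restrict_space space_pair_measure)
  also have "\<dots> = emeasure lborel {0..T} * emeasure circle \<omega>"
    using \<omega> by (intro C.emeasure_pair_measure_Times) auto
  also have "\<dots> < \<infinity>"
    using C.emeasure_finite[of \<omega>, unfolded infinity_ennreal_def less_top]
    by (simp add: ennreal_mult_less_top emeasure_lborel_Icc_eq)
  finally show "emeasure (control_measure \<omega> T) (space (control_measure \<omega> T)) \<noteq> \<infinity>" by simp
qed

lemma sets_sector [measurable]: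
  assumes [measurable]: "\<omega> \<in> sets borel"
  shows "sector \<omega> T \<in> sets borel"
  unfolding sector_def by measurable

text \<open>Polar coordinates followed by \<open>r = e^s\<close>: one factor \<open>e^s\<close> is
  the polar weight \<open>r\<close>, the other comes from \<open>dr = e^s ds\<close>.\<close>

lemma nn_integral_sector:
  assumes \<omega> [measurable]: "\<omega> \<in> sets borel" and "0 < T"
    and f [measurable]: "f \<in> borel_measurable (borel :: complex measure)"
  shows "(\<integral>\<^sup>+z. f z \<partial>restrict_space lborel (sector \<omega> T)) =
    (\<integral>\<^sup>+x. ennreal (exp (2 * fst x)) * f (of_real (exp (fst x)) * snd x) \<partial>control_measure \<omega> T)"
proof -
  interpret sigma_finite_measure circle by (rule sigma_finite_circle)
  define h where "h r = ennreal r * (\<integral>\<^sup>+w. f (of_real r * w) * indicator \<omega> w \<partial>circle)" for r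
  have [measurable]: "h \<in> borel_measurable borel" unfolding h_def by measurable
  have "(\<integral>\<^sup>+z. f z \<partial>restrict_space lborel (sector \<omega> T)) = (\<integral>\<^sup>+z. f z * indicator (sector \<omega> T) z \<partial>lborel)"
    by (subst nn_integral_restrict_space) auto
  also have "\<dots> = (\<integral>\<^sup>+r. ennreal r * (\<integral>\<^sup>+w. f (of_real r * w) * indicator (sector \<omega> T) (of_real r * w) \<partial>circle) * indicator {0<..} r \<partial>lborel)"
    by (rule nn_integral_polar) measurable
  \<comment> \<open>The sector omits the radii 1 and \<open>e^T\<close>. Including them costs a null
    set and gives the closed interval \<open>exp 0..exp T\<close>, the form in which the
    substitution rule accepts it.\<close>
  also have "\<dots> = (\<integral>\<^sup>+r. h r * indicator {exp 0..exp T} r \<partial>lborel)"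
  proof (rule nn_integral_cong_AE)
    have *: "ennreal r * (\<integral>\<^sup>+w. f (of_real r * w) * indicator (sector \<omega> T) (of_real r * w) \<partial>circle) * indicator {0<..} r
        = h r * indicator {exp 0..exp T} r" if r: "r \<noteq> 1" "r \<noteq> exp T" for r
    proof (cases "0 < r")
      case True
      have "(\<integral>\<^sup>+w. f (of_real r * w) * indicator (sector \<omega> T) (of_real r * w) \<partial>circle)
          = (\<integral>\<^sup>+w. f (of_real r * w) * indicator \<omega> w * indicator {exp 0..exp T} r \<partial>circle)"
        by (rule nn_integral_cong_AE, use AE_circle_norm in eventually_elim)
          (use True r in \<open>auto simp: sector_def norm_mult indicator_def\<close>)
      also have "\<dots> = (\<integral>\<^sup>+w. f (of_real r * w) * indicator \<omega> w \<partial>circle) * indicator {exp 0..exp T} r"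
        by (rule nn_integral_multc) measurable
      finally show ?thesis using True by (simp add: h_def mult.assoc)
    qed (auto simp: indicator_def)
    show "AE r in lborel. ennreal r * (\<integral>\<^sup>+w. f (of_real r * w) * indicator (sector \<omega> T) (of_real r * w) \<partial>circle) * indicator {0<..} r
        = h r * indicator {exp 0..exp T} r"
      using AE_lborel_singleton[of "1::real"] AE_lborel_singleton[of "exp T"] by eventually_elim (rule *)
  qed
  also have "\<dots> = (\<integral>\<^sup>+s. h (exp s) * ennreal (exp s) * indicator {0..T} s \<partial>lborel)"
    by (rule nn_integral_substitution_aux)
      (use \<open>0 < T\<close> in \<open>auto intro!: derivative_eq_intros continuous_intros\<close>)
  also have "\<dots> = (\<integral>\<^sup>+s. (\<integral>\<^sup>+w. ennreal (exp (2 * s)) * f (of_real (exp s) * w) * indicator \<omega> w \<partial>circle) * indicator {0..T} s \<partial>lborel)"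
  proof (rule nn_integral_cong)
    fix s :: real
    have "(\<integral>\<^sup>+w. ennreal (exp (2 * s)) * f (of_real (exp s) * w) * indicator \<omega> w \<partial>circle)
        = ennreal (exp (2 * s)) * (\<integral>\<^sup>+w. f (of_real (exp s) * w) * indicator \<omega> w \<partial>circle)"
      unfolding mult.assoc by (rule nn_integral_cmult) measurable
    also have "\<dots> = h (exp s) * ennreal (exp s)"
      unfolding mult_2 exp_add by (simp add: h_def ennreal_mult mult_ac)
    finally show "h (exp s) * ennreal (exp s) * indicator {0..T} s =
        (\<integral>\<^sup>+w. ennreal (exp (2 * s)) * f (of_real (exp s) * w) * indicator \<omega> w \<partial>circle) * indicator {0..T} s"
      by simp
  qed
  also have "\<dots> = (\<integral>\<^sup>+x. ennreal (exp (2 * fst x)) * f (of_real (exp (fst x)) * snd x) \<partial>control_measure \<omega> T)"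
    by (subst nn_integral_control_measure[OF \<omega>]) auto
  finally show ?thesis .
qed

text \<open>Pullback of \<open>p\<close> to the cylinder on which the control lives. For monomials
  these are, up to a constant, the functions against which the control is integrated in the Fourier
  coefficients of the Duhamel term.\<close>

definition poly_polar :: "complex poly \<Rightarrow> real \<times> complex \<Rightarrow> complex" where
  "poly_polar p x = poly p (of_real (exp (fst x)) * snd x)"

lemma borel_measurable_poly [measurable (raw)]:
  fixes f :: "'a \<Rightarrow> complex"
  assumes "f \<in> borel_measurable M"
  shows "(\<lambda>x. poly p (f x)) \<in> borel_measurable M"
  by (rule measurable_compose[OF assms borel_measurable_continuous_onI]) (intro continuous_intros)

lemma sets_control_measure:
  "sets (control_measure \<omega> T) = sets (restrict_space (borel \<Otimes>\<^sub>M borel) ({0..T} \<times> \<omega>))"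
  unfolding control_measure_def by (intro sets_restrict_space_cong sets_pair_measure_cong) auto

lemma borel_measurable_control_measure:
  "f \<in> borel_measurable (borel \<Otimes>\<^sub>M borel) \<Longrightarrow> f \<in> borel_measurable (control_measure \<omega> T)"
  by (subst measurable_cong_sets[OF sets_control_measure refl]) (rule measurable_restrict_space1)

lemma borel_measurable_poly_polar: "poly_polar p \<in> borel_measurable (control_measure \<omega> T)"
  unfolding poly_polar_def[abs_def] by (rule borel_measurable_control_measure) measurable

lemma poly_polar_L2:
  assumes \<omega>: "\<omega> \<in> sets borel" "\<omega> \<subseteq> sphere 0 1"
  shows "poly_polar p \<in> L2_fun (control_measure \<omega> T)"
proof -
  have "bounded (poly p ` cball 0 (exp T))"
    by (intro compact_imp_bounded compact_continuous_image continuous_intros) auto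
  then obtain B where B: "\<And>z. cmod z \<le> exp T \<Longrightarrow> cmod (poly p z) \<le> B"
    unfolding bounded_iff by (metis image_eqI mem_cball_0)
  show ?thesis
  proof (rule L2_fun_bounded[OF finite_measure_control[OF \<omega>(1)] borel_measurable_poly_polar])
    fix x assume "x \<in> space (control_measure \<omega> T)"
    then have "fst x \<le> T" "cmod (snd x) = 1"
      using \<omega>(2) by (auto simp: control_measure_def space_restrict_space)
    then show "cmod (poly_polar p x) \<le> B"
      unfolding poly_polar_def by (intro B) (simp add: norm_mult)
  qed
qed

lemma L2_norm_eq_nn_integral:
  assumes [measurable]: "f \<in> borel_measurable M"
  shows "L2_norm M f = sqrt (enn2real (\<integral>\<^sup>+x. ennreal ((cmod (f x))\<^sup>2) \<partial>M))"
  unfolding L2_norm_def by (subst integral_eq_nn_integral) auto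

lemma
  assumes \<omega>: "\<omega> \<in> sets borel" "\<omega> \<subseteq> sphere 0 1" and "0 < T"
  shows L2_norm_poly_polar_le: "L2_norm (control_measure \<omega> T) (poly_polar p) \<le> bergman_norm (sector \<omega> T) (poly p)"
    and bergman_norm_le: "bergman_norm (sector \<omega> T) (poly p) \<le> exp T * L2_norm (control_measure \<omega> T) (poly_polar p)"
proof -
  let ?C = "control_measure \<omega> T"
  define A where "A = (\<integral>\<^sup>+z. ennreal ((cmod (poly p z))\<^sup>2) \<partial>restrict_space lborel (sector \<omega> T))"
  define B where "B = (\<integral>\<^sup>+x. ennreal ((cmod (poly_polar p x))\<^sup>2) \<partial>?C)"
  have A: "bergman_norm (sector \<omega> T) (poly p) = sqrt (enn2real A)"
    unfolding bergman_norm_def A_def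
    by (rule L2_norm_eq_nn_integral) (auto intro!: measurable_restrict_space1 borel_measurable_poly)
  have B: "L2_norm ?C (poly_polar p) = sqrt (enn2real B)"
    unfolding B_def by (rule L2_norm_eq_nn_integral[OF borel_measurable_poly_polar])
  have A_eq: "A = (\<integral>\<^sup>+x. ennreal (exp (2 * fst x)) * ennreal ((cmod (poly_polar p x))\<^sup>2) \<partial>?C)"
    unfolding A_def poly_polar_def by (rule nn_integral_sector[OF \<omega>(1) \<open>0 < T\<close>]) measurable
  have fst: "0 \<le> fst x" "fst x \<le> T" if "x \<in> space ?C" for x
    using that by (auto simp: control_measure_def space_restrict_space)
  have BA: "B \<le> A"
    unfolding A_eq B_def
  proof (rule nn_integral_mono)
    fix x assume "x \<in> space ?C"
    then have "1 \<le> ennreal (exp (2 * fst x))"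
      using fst by (subst ennreal_1[symmetric]) (intro ennreal_leI, simp)
    then show "ennreal ((cmod (poly_polar p x))\<^sup>2) \<le> ennreal (exp (2 * fst x)) * ennreal ((cmod (poly_polar p x))\<^sup>2)"
      using mult_right_mono[of 1 "ennreal (exp (2 * fst x))"] by fastforce
  qed
  have AB: "A \<le> ennreal (exp (2 * T)) * B"
  proof -
    have "A \<le> (\<integral>\<^sup>+x. ennreal (exp (2 * T)) * ennreal ((cmod (poly_polar p x))\<^sup>2) \<partial>?C)"
      unfolding A_eq by (intro nn_integral_mono mult_right_mono ennreal_leI) (auto simp: fst)
    also have "\<dots> = ennreal (exp (2 * T)) * B"
      unfolding B_def using borel_measurable_poly_polar[of p \<omega> T] by (intro nn_integral_cmult) measurable
    finally show ?thesis .
  qed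
  \<comment> \<open>Finiteness comes before the passage to real numbers, because
    \<open>enn2real\<close> sends infinity to 0 and is monotone only below it.\<close>
  have "B < \<infinity>"
    using poly_polar_L2[OF \<omega>, of p T] unfolding B_def L2_fun_def integrable_iff_bounded by simp
  then have A_fin: "A < \<infinity>" and B_fin: "B < \<infinity>"
    using AB by (auto intro: le_less_trans simp: ennreal_mult_less_top)
  show "L2_norm ?C (poly_polar p) \<le> bergman_norm (sector \<omega> T) (poly p)"
    unfolding A B using BA A_fin by (intro real_sqrt_le_mono enn2real_mono) auto
  have "enn2real A \<le> enn2real (ennreal (exp (2 * T)) * B)"
    using AB B_fin by (intro enn2real_mono) (auto simp: ennreal_mult_less_top)
  also have "\<dots> = (exp T)\<^sup>2 * enn2real B"
    by (simp add: enn2real_mult exp_double)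
  finally have "sqrt (enn2real A) \<le> sqrt ((exp T)\<^sup>2 * enn2real B)"
    by (rule real_sqrt_le_mono)
  then show "bergman_norm (sector \<omega> T) (poly p) \<le> exp T * L2_norm ?C (poly_polar p)"
    unfolding A B by (simp add: real_sqrt_mult)
qed

section \<open>The Duhamel integrand as a single multiplier\<close>

lemma halfheat_riesz_eq_multiplier:
  "halfheat_semigroup t (riesz_proj f) =
    fourier_multiplier (\<lambda>n. of_real (exp (- \<bar>real_of_int n\<bar> * t)) * (if 0 \<le> n then 1 else 0)) f"
  unfolding halfheat_semigroup_eq_multiplier riesz_proj_eq_multiplier
  by (rule fourier_multiplier_compose) auto

text \<open>Replaces the limit over finite index sets by the limit of a sequence, so that
  measurability in time passes to the sum.\<close>

lemma fourier_multiplier_LIMSEQ: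
  assumes a: "\<And>n. cmod (a n) \<le> 1"
  shows "(\<lambda>N. \<Sum>n\<in>{- int N..int N}. fourier_mode n (a n * fourier_coeff f n)) \<longlonglongrightarrow> fourier_multiplier a f"
proof -
  have "filterlim (\<lambda>N. {- int N..int N}) (finite_subsets_at_top UNIV) sequentially"
    unfolding filterlim_finite_subsets_at_top
  proof (intro allI impI)
    fix X :: "int set" assume "finite X \<and> X \<subseteq> UNIV"
    then obtain N where N: "\<And>n. n \<in> X \<Longrightarrow> nat \<bar>n\<bar> \<le> N"
      using finite_nat_set_iff_bounded_le[of "(\<lambda>n. nat \<bar>n\<bar>) ` X"] by auto
    show "\<forall>\<^sub>F N in sequentially. finite {- int N..int N} \<and> X \<subseteq> {- int N..int N} \<and> {- int N..int N} \<subseteq> UNIV"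
      using eventually_ge_at_top[of N] by eventually_elim (use N in force)
  qed
  with has_sum_fourier_multiplier[OF a] show ?thesis
    unfolding has_sum_def by (rule filterlim_compose)
qed

section \<open>The Duhamel formula and null-controllability\<close>

lemma L2_fun_control_extend:
  assumes \<omega>: "\<omega> \<in> sets borel" and u: "u \<in> L2_fun (control_measure \<omega> T)"
  shows "(\<lambda>x. indicator ({0..T} \<times> \<omega>) x *\<^sub>R u x) \<in> L2_fun (lborel \<Otimes>\<^sub>M circle)"
proof -
  let ?M = "lborel \<Otimes>\<^sub>M circle :: (real \<times> complex) measure"
  let ?\<Omega> = "{0..T} \<times> \<omega>"
  have \<Omega>: "?\<Omega> \<inter> space ?M \<in> sets ?M" using sets_cylinder[OF \<omega>] by (simp add: space_pair_measure)
  have "integrable (restrict_space ?M ?\<Omega>) (\<lambda>x. (cmod (u x))\<^sup>2)"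
    using u by (simp add: L2_fun_def control_measure_def)
  then have "integrable ?M (\<lambda>x. indicator ?\<Omega> x *\<^sub>R (cmod (u x))\<^sup>2)"
    by (subst (asm) integrable_restrict_space[OF \<Omega>])
  moreover have "indicator ?\<Omega> x *\<^sub>R (cmod (u x))\<^sup>2 = (cmod (indicator ?\<Omega> x *\<^sub>R u x))\<^sup>2" for x
    by (simp add: indicator_def)
  ultimately show ?thesis
    using u borel_measurable_restrict_space_iff[OF \<Omega>, of u]
    by (simp add: L2_fun_def control_measure_def)
qed

lemma fourier_coeff_L2T_of:
  assumes "f \<in> L2_fun circle"
  shows "fourier_coeff (L2T_of f) n = (LINT z|circle. f z * cnj (z powi n)) / (2 * pi)"
  using assms L2_fun_mode[of 1 n]
  by (simp add: fourier_coeff_def L2_cinner_L2T_of L2_inner_def)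

text \<open>Extended by zero, the control is square integrable on the whole product, so by Fubini
  almost every time slice lies in L2 of the circle. The integrand is measurable as a limit of
  symmetric partial sums and is dominated because the multipliers are contractions. A Fourier
  coefficient is a bounded functional, so it moves inside the Bochner integral, and Fubini turns the
  double integral into an inner product on the cylinder.\<close>

lemma
  fixes u :: "real \<times> complex \<Rightarrow> complex"
  assumes \<omega>: "\<omega> \<in> sets borel" "\<omega> \<subseteq> sphere 0 1" and u: "u \<in> L2_fun (control_measure \<omega> T)"
  defines "G \<equiv> \<lambda>s. halfheat_semigroup (T - s) (riesz_proj (extend_by_zero \<omega> u s))"
  shows set_integrable_duhamel: "set_integrable lborel {0..T} G"
    and fourier_coeff_duhamel: "fourier_coeff (LINT s:{0..T}|lborel. G s) n =
      (if 0 \<le> n then exp (- (real_of_int n * T)) *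
        L2_inner (control_measure \<omega> T) u (poly_polar (monom 1 (nat n))) / (2 * pi) else 0)"
proof -
  interpret C: sigma_finite_measure circle by (rule sigma_finite_circle)
  interpret P: pair_sigma_finite lborel circle by unfold_locales
  let ?M = "lborel \<Otimes>\<^sub>M circle :: (real \<times> complex) measure"
  let ?\<Omega> = "{0..T} \<times> \<omega>"
  define v where "v x = indicator ?\<Omega> x *\<^sub>R u x" for x
  have vL2: "v \<in> L2_fun ?M" unfolding v_def[abs_def] by (rule L2_fun_control_extend[OF \<omega>(1) u])
  then have v_meas [measurable]: "v \<in> borel_measurable ?M" and v_int: "integrable ?M (\<lambda>x. (cmod (v x))\<^sup>2)"
    by (auto simp: L2_fun_def)
  have slice: "extend_by_zero \<omega> u s = L2T_of (\<lambda>z. v (s, z))" if "s \<in> {0..T}" for s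
  proof -
    have "(if z \<in> \<omega> then u (s, z) else 0) = v (s, z)" for z
      using that by (simp add: v_def indicator_def)
    then show ?thesis by (simp add: extend_by_zero_def)
  qed
  have slice_meas [measurable]: "(\<lambda>z. v (s, z)) \<in> borel_measurable circle" for s
    by (rule measurable_compose[OF _ v_meas]) auto
  define I where "I s \<longleftrightarrow> integrable circle (\<lambda>z. (cmod (v (s, z)))\<^sup>2)" for s
  have I_iff: "I s \<longleftrightarrow> (\<lambda>z. v (s, z)) \<in> L2_fun circle" for s
    by (auto simp: I_def L2_fun_def)
  have I_meas [measurable]: "Measurable.pred lborel I"
    unfolding I_def[abs_def] by measurable
  have AE_I: "AE s in lborel. I s"
    unfolding I_def by (rule P.AE_integrable_fst'[OF v_int])
  \<comment> \<open>At the exceptional times \<open>L2T_of\<close> gives 0 by convention. Setting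
    \<open>c n s\<close> to 0 there makes \<open>c_eq\<close> hold at every time, so the measurable
    partial sums converge to the integrand everywhere and not just almost everywhere.\<close>
  define c where "c n s = (if I s then (LINT z|circle. v (s, z) * cnj (z powi n)) / (2 * pi) else 0)" for n s
  have c_meas [measurable]: "c n \<in> borel_measurable lborel" for n
    unfolding c_def[abs_def] by measurable
  have c_eq: "fourier_coeff (L2T_of (\<lambda>z. v (s, z))) n = c n s" for n s
  proof (cases "I s")
    case True
    then show ?thesis by (simp add: c_def I_iff fourier_coeff_L2T_of)
  next
    case False
    then show ?thesis
      using linear_0[OF bounded_linear.linear[OF bounded_linear_fourier_coeff]]
      by (simp add: c_def I_iff L2T_of_def)
  qed
  define a where "a s n = complex_of_real (exp (- \<bar>real_of_int n\<bar> * (T - s))) * (if 0 \<le> n then 1 else 0)" for s n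
  have a_le: "cmod (a s n) \<le> 1" if "s \<in> {0..T}" for s n
    using that by (auto simp: a_def norm_mult intro!: mult_nonneg_nonneg)
  have G: "G s = fourier_multiplier (a s) (L2T_of (\<lambda>z. v (s, z)))" if "s \<in> {0..T}" for s
    unfolding G_def slice[OF that] halfheat_riesz_eq_multiplier a_def[abs_def] ..
  have G_meas: "(\<lambda>s. indicator {0..T} s *\<^sub>R G s) \<in> borel_measurable lborel"
  proof (rule borel_measurable_LIMSEQ_metric)
    have [measurable]: "fourier_mode n \<in> borel_measurable borel" for n
      by (intro borel_measurable_continuous_onI linear_continuous_on bounded_linear_fourier_mode)
    show "(\<lambda>s. indicator {0..T} s *\<^sub>R (\<Sum>n\<in>{- int N..int N}. fourier_mode n (a s n * c n s))) \<in> borel_measurable lborel" for N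
      unfolding a_def by measurable
    show "(\<lambda>N. indicator {0..T} s *\<^sub>R (\<Sum>n\<in>{- int N..int N}. fourier_mode n (a s n * c n s)))
        \<longlonglongrightarrow> indicator {0..T} s *\<^sub>R G s" for s
    proof (cases "s \<in> {0..T}")
      case True
      then show ?thesis
        using fourier_multiplier_LIMSEQ[of "a s" "L2T_of (\<lambda>z. v (s, z))", OF a_le[OF True]] by (simp add: G c_eq)
    qed simp
  qed
  show G_int: "set_integrable lborel {0..T} G"
    unfolding set_integrable_def
  proof (rule Bochner_Integration.integrable_bound[OF _ G_meas])
    \<comment> \<open>The slice norms are only known to be square integrable in time;
      \<open>x \<le> 1 + x^2\<close> on a bounded interval turns this into an integrable
      majorant.\<close>
    show "integrable lborel (\<lambda>s. indicator {0..T} s *\<^sub>R (1::real) + (LINT z|circle. (cmod (v (s, z)))\<^sup>2))"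
      using integrable_real_indicator[of "{0..T}" lborel]
      by (intro Bochner_Integration.integrable_add[OF _ P.integrable_fst'[OF v_int]])
        (simp add: emeasure_lborel_Icc_eq)
    have "norm (indicator {0..T} s *\<^sub>R G s) \<le> norm (indicator {0..T} s *\<^sub>R 1 + (LINT z|circle. (cmod (v (s, z)))\<^sup>2))" for s
    proof (cases "s \<in> {0..T}")
      case True
      define x where "x = L2T_of (\<lambda>z. v (s, z))"
      have "norm x \<le> 1 + (LINT z|circle. (cmod (v (s, z)))\<^sup>2)"
      proof (cases "I s")
        case True
        then have "(norm x)\<^sup>2 = (LINT z|circle. (cmod (v (s, z)))\<^sup>2)"
          by (simp add: x_def I_iff norm_L2T_of L2_norm_power2)
        moreover have "norm x \<le> 1 + (norm x)\<^sup>2"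
          using sum_squares_bound[of 1 "norm x"] norm_ge_zero[of x] unfolding power_one mult_1_right by linarith
        ultimately show ?thesis by simp
      next
        case False
        then have "norm x = 0" by (simp add: x_def I_iff L2T_of_def)
        moreover have "0 \<le> (LINT z|circle. (cmod (v (s, z)))\<^sup>2)" by simp
        ultimately show ?thesis by linarith
      qed
      moreover have "norm (G s) \<le> norm x"
        unfolding G[OF True] x_def by (rule norm_fourier_multiplier_le[OF a_le[OF True]])
      ultimately show ?thesis using True by simp
    qed simp
    then show "AE s in lborel. norm (indicator {0..T} s *\<^sub>R G s) \<le> norm (indicator {0..T} s *\<^sub>R 1 + (LINT z|circle. (cmod (v (s, z)))\<^sup>2))"
      by simp
  qed
  let ?e = "poly_polar (monom 1 (nat n))"
  \<comment> \<open>The part of \<open>exp (- n * (T - s)) / (2 * pi)\<close> that does not depend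
    on \<open>s\<close>; the rest, \<open>exp (n * s)\<close>, is absorbed into the monomial
    \<open>?e\<close>.\<close>
  define q where "q = complex_of_real (exp (- (real_of_int n * T)) / (2 * pi))"
  have eL2: "?e \<in> L2_fun (control_measure \<omega> T)" by (rule poly_polar_L2[OF \<omega>])
  have \<Omega>: "?\<Omega> \<inter> space ?M \<in> sets ?M" using sets_cylinder[OF \<omega>(1)] by (simp add: space_pair_measure)
  have int_ue: "integrable (control_measure \<omega> T) (\<lambda>x. q * (u x * cnj (?e x)))"
    using L2_fun_integrable_mult_cnj[OF u eL2] by simp
  have int_ve: "integrable ?M (\<lambda>x. q * (v x * cnj (?e x)))"
  proof -
    have "integrable ?M (\<lambda>x. indicator ?\<Omega> x *\<^sub>R (q * (u x * cnj (?e x))))"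
      using int_ue unfolding control_measure_def by (subst (asm) integrable_restrict_space[OF \<Omega>])
    moreover have "indicator ?\<Omega> x *\<^sub>R (q * (u x * cnj (?e x))) = q * (v x * cnj (?e x))" for x
      by (simp add: v_def indicator_def)
    ultimately show ?thesis by simp
  qed
  have lin: "bounded_linear (\<lambda>f. fourier_coeff f n)" by (rule bounded_linear_fourier_coeff)
  have coeff: "fourier_coeff (indicator {0..T} s *\<^sub>R G s) n = indicator {0..T} s *\<^sub>R (a s n * c n s)" for s
    using linear_0[OF bounded_linear.linear[OF lin]]
    by (cases "s \<in> {0..T}") (simp_all add: G fourier_coeff_multiplier[OF a_le] c_eq)
  have coeff_int: "fourier_coeff (LINT s:{0..T}|lborel. G s) n = (LINT s|lborel. indicator {0..T} s *\<^sub>R (a s n * c n s))"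
    unfolding set_lebesgue_integral_def
    by (subst integral_bounded_linear[OF lin G_int[unfolded set_integrable_def], symmetric]) (simp add: coeff)
  show "fourier_coeff (LINT s:{0..T}|lborel. G s) n =
      (if 0 \<le> n then exp (- (real_of_int n * T)) * L2_inner (control_measure \<omega> T) u ?e / (2 * pi) else 0)"
  proof (cases "0 \<le> n")
    case False
    then show ?thesis unfolding coeff_int by (simp add: a_def)
  next
    case True
    have "(LINT s|lborel. indicator {0..T} s *\<^sub>R (a s n * c n s)) = (LINT s|lborel. LINT z|circle. q * (v (s, z) * cnj (?e (s, z))))"
    proof (rule integral_cong_AE)
      show "(\<lambda>s. indicator {0..T} s *\<^sub>R (a s n * c n s)) \<in> borel_measurable lborel"
        unfolding a_def by measurable
      show "(\<lambda>s. LINT z|circle. q * (v (s, z) * cnj (?e (s, z)))) \<in> borel_measurable lborel"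
        using P.integrable_fst'[OF int_ve] by auto
      show "AE s in lborel. indicator {0..T} s *\<^sub>R (a s n * c n s) = (LINT z|circle. q * (v (s, z) * cnj (?e (s, z))))"
        using AE_I
      proof eventually_elim
        case (elim s)
        show ?case
        proof (cases "s \<in> {0..T}")
          case False
          then have "v (s, z) = 0" for z by (auto simp: v_def indicator_def)
          then show ?thesis using False by simp
        next
          case s: True
          have n: "z powi n = z ^ nat n" for z :: complex
            using True by (simp add: power_int_def)
          have "exp s ^ nat n = exp (n * s)"
            using True exp_of_nat_mult[of "nat n" s] by simp
          then have e: "?e (s, z) = of_real (exp (n * s)) * z powi n" for z
            by (simp add: poly_polar_def poly_monom power_mult_distrib n flip: of_real_power)
          have "a s n / (2 * pi) = q * of_real (exp (n * s))"
          proof -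
            have "exp (- \<bar>real_of_int n\<bar> * (T - s)) = exp (- (real_of_int n * T)) * exp (n * s)"
              unfolding exp_add[symmetric] using True by (simp add: algebra_simps)
            then show ?thesis using True by (simp add: a_def q_def)
          qed
          moreover have "a s n * c n s = (a s n / (2 * pi)) * (LINT z|circle. v (s, z) * cnj (z powi n))"
            using elim by (simp add: c_def)
          ultimately have "a s n * c n s = (LINT z|circle. q * of_real (exp (n * s)) * (v (s, z) * cnj (z powi n)))"
            by (simp only: integral_mult_right_zero)
          moreover have "q * (v (s, z) * cnj (?e (s, z))) = q * of_real (exp (n * s)) * (v (s, z) * cnj (z powi n))" for z
            unfolding e by (simp only: complex_cnj_mult complex_cnj_complex_of_real mult_ac)
          ultimately show ?thesis using s by (simp only:) simp
        qed
      qed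
    qed
    also have "\<dots> = (LINT x|?M. q * (v x * cnj (?e x)))"
      by (rule P.integral_fst'[OF int_ve])
    also have "\<dots> = (LINT x|?M. indicator ?\<Omega> x *\<^sub>R (q * (u x * cnj (?e x))))"
      by (rule Bochner_Integration.integral_cong) (simp_all add: v_def indicator_def)
    also have "\<dots> = q * L2_inner (control_measure \<omega> T) u ?e"
      unfolding control_measure_def L2_inner_def
      by (subst integral_restrict_space[OF \<Omega>, symmetric]) simp
    finally show ?thesis unfolding coeff_int using True by (simp add: q_def)
  qed
qed

text \<open>The multiplier with constant symbol 1 projects onto the closed span of the modes. It
  fixes the values of the semigroup at nonnegative times and commutes with the Bochner integral, so
  a solution whose coefficients all vanish is 0.\<close>

lemma fourier_multiplier_one_solution:
  assumes \<omega>: "\<omega> \<in> sets borel" "\<omega> \<subseteq> sphere 0 1" and u: "u \<in> L2_fun (control_measure \<omega> T)" and "0 \<le> T"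
  shows "fourier_multiplier (\<lambda>_. 1) (solution \<omega> u f0 T) = solution \<omega> u f0 T"
proof -
  let ?P = "fourier_multiplier (\<lambda>_. 1)"
  define G where "G s = halfheat_semigroup (T - s) (riesz_proj (extend_by_zero \<omega> u s))" for s
  have P: "bounded_linear ?P" by (rule bounded_linear_fourier_multiplier) simp
  have 1: "?P (halfheat_semigroup t f) = halfheat_semigroup t f" if "0 \<le> t" for t f
    unfolding halfheat_semigroup_eq_multiplier
    by (subst fourier_multiplier_compose) (use that in auto)
  have "?P (LINT s:{0..T}|lborel. G s) = (LINT s:{0..T}|lborel. ?P (G s))"
    using set_integrable_duhamel[OF \<omega> u]
      integral_bounded_linear[OF P, of lborel "\<lambda>s. indicator {0..T} s *\<^sub>R G s"]
      linear_scale[OF bounded_linear.linear[OF P]]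
    by (simp add: set_lebesgue_integral_def set_integrable_def G_def)
  also have "\<dots> = (LINT s:{0..T}|lborel. G s)"
    by (rule set_lebesgue_integral_cong) (auto simp: G_def 1)
  finally show ?thesis
    unfolding solution_def G_def[symmetric] linear_add[OF bounded_linear.linear[OF P]] using 1[OF \<open>0 \<le> T\<close>] by simp
qed

section \<open>Pairings with polynomials, reduced to monomials\<close>

lemma L2_inner_sum_right:
  assumes "f \<in> L2_fun M" "\<And>i. g i \<in> L2_fun M"
  shows "L2_inner M f (\<lambda>x. \<Sum>i\<in>A. c i * g i x) = (\<Sum>i\<in>A. cnj (c i) * L2_inner M f (g i))"
proof -
  have "L2_inner M f (\<lambda>x. \<Sum>i\<in>A. c i * g i x) = (LINT x|M. (\<Sum>i\<in>A. cnj (c i) * (f x * cnj (g i x))))"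
    by (simp add: L2_inner_def sum_distrib_left mult_ac)
  also have "\<dots> = (\<Sum>i\<in>A. cnj (c i) * L2_inner M f (g i))"
    using assms by (simp add: L2_inner_def L2_fun_integrable_mult_cnj)
  finally show ?thesis .
qed

lemma L2_fun_circle_poly: "poly p \<in> L2_fun circle"
proof -
  have "bounded (poly p ` sphere 0 1)"
    by (intro compact_imp_bounded compact_continuous_image continuous_intros) auto
  then obtain B where "\<And>z. cmod z = 1 \<Longrightarrow> cmod (poly p z) \<le> B"
    unfolding bounded_iff by (metis image_eqI mem_sphere_0)
  then show ?thesis by (intro L2_fun_circle_bounded) measurable
qed

lemma L2_cinner_poly:
  "L2_cinner f (L2T_of (poly p)) = (\<Sum>i\<le>degree p. cnj (coeff p i) * (2 * pi * fourier_coeff f (int i)))"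
proof -
  obtain h where h: "h \<in> L2_fun circle" "f = L2T_of h" by (rule L2T_cases)
  have p: "poly p = (\<lambda>z. \<Sum>i\<le>degree p. coeff p i * z powi int i)"
    by (simp add: poly_altdef fun_eq_iff)
  have powi: "(\<lambda>z. z powi n) \<in> L2_fun circle" for n using L2_fun_mode[of 1 n] by simp
  have "L2_cinner f (L2T_of (poly p)) = L2_inner circle h (poly p)"
    by (simp add: h L2_cinner_L2T_of L2_fun_circle_poly)
  also have "\<dots> = (\<Sum>i\<le>degree p. cnj (coeff p i) * L2_inner circle h (\<lambda>z. z powi int i))"
    by (subst p) (rule L2_inner_sum_right[OF h(1) powi])
  also have "\<dots> = (\<Sum>i\<le>degree p. cnj (coeff p i) * (2 * pi * fourier_coeff f (int i)))"
    by (simp add: fourier_coeff_def h L2_cinner_L2T_of powi del: power_int_of_nat)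
  finally show ?thesis .
qed

lemma L2_inner_poly_polar:
  assumes \<omega>: "\<omega> \<in> sets borel" "\<omega> \<subseteq> sphere 0 1" and u: "u \<in> L2_fun (control_measure \<omega> T)"
  shows "L2_inner (control_measure \<omega> T) u (poly_polar p) =
    (\<Sum>i\<le>degree p. cnj (coeff p i) * L2_inner (control_measure \<omega> T) u (poly_polar (monom 1 i)))"
proof -
  have p: "poly_polar p = (\<lambda>x. \<Sum>i\<le>degree p. coeff p i * poly_polar (monom 1 i) x)"
    by (simp add: poly_polar_def poly_altdef[of p] poly_monom fun_eq_iff)
  show ?thesis by (subst p) (rule L2_inner_sum_right[OF u poly_polar_L2[OF \<omega>]])
qed

text \<open>For \<open>n \<ge> 0\<close> the coefficient of the final state is a nonzero multiple of
  \<open>2 * pi * fourier_coeff f0 n\<close> plus the pairing of \<open>u\<close> with the n-th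
  monomial. For \<open>n < 0\<close> it vanishes, since \<open>f0\<close> is in \<open>H2\<close>
  and the control is projected. The conditions on monomials extend to polynomials because both sides
  are conjugate linear in \<open>p\<close>.\<close>

lemma steers_to_zero_iff:
  assumes \<omega>: "\<omega> \<in> sets borel" "\<omega> \<subseteq> sphere 0 1" and u: "u \<in> L2_fun (control_measure \<omega> T)"
    and "0 \<le> T" and f0: "f0 \<in> H2"
  shows "steers_to_zero \<omega> T u f0 \<longleftrightarrow>
    (\<forall>p. L2_cinner f0 (L2T_of (poly p)) = - L2_inner (control_measure \<omega> T) u (poly_polar p))"
proof -
  let ?x = "solution \<omega> u f0 T"
  let ?e = "\<lambda>i. L2_inner (control_measure \<omega> T) u (poly_polar (monom 1 i))"
  have decay: "cmod (of_real (exp (- \<bar>real_of_int n\<bar> * T))) \<le> 1" for n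
    using \<open>0 \<le> T\<close> by simp
  have lin: "linear (\<lambda>f. fourier_coeff f n)" for n
    by (rule bounded_linear.linear[OF bounded_linear_fourier_coeff])
  have coeff: "fourier_coeff ?x n = (if 0 \<le> n then
      exp (- (real_of_int n * T)) * (2 * pi * fourier_coeff f0 n + ?e (nat n)) / (2 * pi) else 0)" for n
    unfolding solution_def linear_add[OF lin] fourier_coeff_duhamel[OF \<omega> u]
    unfolding halfheat_semigroup_eq_multiplier fourier_coeff_multiplier[OF decay]
    by (auto simp: fourier_coeff_H2_neg[OF f0] field_simps)
  have "steers_to_zero \<omega> T u f0 \<longleftrightarrow> (\<forall>n. fourier_coeff ?x n = 0)"
  proof
    assume "\<forall>n. fourier_coeff ?x n = 0"
    then have "fourier_multiplier (\<lambda>_. 1) ?x = 0"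
      by (simp add: fourier_multiplier_def)
    then show "steers_to_zero \<omega> T u f0"
      using fourier_multiplier_one_solution[OF \<omega> u \<open>0 \<le> T\<close>, of f0] by (simp add: steers_to_zero_def)
  qed (simp add: steers_to_zero_def linear_0[OF lin])
  also have "\<dots> \<longleftrightarrow> (\<forall>i. 2 * pi * fourier_coeff f0 (int i) = - ?e i)"
  proof
    assume *: "\<forall>n. fourier_coeff ?x n = 0"
    show "\<forall>i. 2 * pi * fourier_coeff f0 (int i) = - ?e i"
    proof
      fix i show "2 * pi * fourier_coeff f0 (int i) = - ?e i"
        using *[rule_format, of "int i"] by (simp add: coeff eq_neg_iff_add_eq_0)
    qed
  next
    assume *: "\<forall>i. 2 * pi * fourier_coeff f0 (int i) = - ?e i"
    show "\<forall>n. fourier_coeff ?x n = 0"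
    proof
      fix n show "fourier_coeff ?x n = 0"
      proof (cases "0 \<le> n")
        case True
        then have "2 * pi * fourier_coeff f0 n = - ?e (nat n)" using *[rule_format, of "nat n"] by simp
        then show ?thesis using True unfolding coeff by (simp only: if_True) simp
      qed (simp add: coeff)
    qed
  qed
  also have "\<dots> \<longleftrightarrow> (\<forall>p. L2_cinner f0 (L2T_of (poly p)) = - L2_inner (control_measure \<omega> T) u (poly_polar p))"
  proof
    assume *: "\<forall>i. 2 * pi * fourier_coeff f0 (int i) = - ?e i"
    show "\<forall>p. L2_cinner f0 (L2T_of (poly p)) = - L2_inner (control_measure \<omega> T) u (poly_polar p)"
    proof
      fix p
      have "L2_cinner f0 (L2T_of (poly p)) = (\<Sum>i\<le>degree p. cnj (coeff p i) * - ?e i)"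
        unfolding L2_cinner_poly using * by simp
      then show "L2_cinner f0 (L2T_of (poly p)) = - L2_inner (control_measure \<omega> T) u (poly_polar p)"
        by (subst L2_inner_poly_polar[OF \<omega> u]) (simp add: sum_negf)
    qed
  next
    assume *: "\<forall>p. L2_cinner f0 (L2T_of (poly p)) = - L2_inner (control_measure \<omega> T) u (poly_polar p)"
    show "\<forall>i. 2 * pi * fourier_coeff f0 (int i) = - ?e i"
    proof
      fix i
      have "poly (monom 1 i) = (\<lambda>z::complex. z powi int i)" by (simp add: poly_monom fun_eq_iff)
      then have "L2_cinner f0 (L2T_of (poly (monom 1 i))) = 2 * pi * fourier_coeff f0 (int i)"
        by (simp add: fourier_coeff_def)
      then show "2 * pi * fourier_coeff f0 (int i) = - ?e i" using * by simp
    qed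
  qed
  finally show ?thesis .
qed

theorem proposition1p2:
  fixes \<omega> :: "complex set" and T :: real and f0 :: L2T
  assumes "openin (top_of_set (sphere 0 1)) \<omega>" and "\<omega> \<noteq> sphere 0 1"
    and "T > 0" and "f0 \<in> H2"
  shows "(f0 \<in> null_controllable \<omega> T \<longleftrightarrow>
      (\<exists>C>0. \<forall>p :: complex poly.
        cmod (L2_cinner f0 (L2T_of (poly p))) \<le> C * bergman_norm (sector \<omega> T) (poly p)))
    \<and> (\<forall>C>0. (\<forall>p :: complex poly.
        cmod (L2_cinner f0 (L2T_of (poly p))) \<le> C * bergman_norm (sector \<omega> T) (poly p)) \<longrightarrow>
      (\<exists>u \<in> L2_fun (control_measure \<omega> T). steers_to_zero \<omega> T u f0 \<and>
        L2_norm (control_measure \<omega> T) u \<le> exp T * C))"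
proof -
  let ?M = "control_measure \<omega> T"
  obtain U where "open U" "\<omega> = sphere 0 1 \<inter> U"
    using assms(1) by (auto simp: openin_open)
  then have \<omega>: "\<omega> \<in> sets borel" "\<omega> \<subseteq> sphere 0 1"
    by (auto intro!: sets.Int borel_closed borel_open)
  obtain h where h: "h \<in> L2_fun circle" "f0 = L2T_of h" by (rule L2T_cases)
  have pairing: "L2_cinner f0 (L2T_of (poly p)) = L2_inner circle h (poly p)" for p
    by (simp add: h L2_cinner_L2T_of L2_fun_circle_poly)
  have steer: "\<exists>u\<in>L2_fun ?M. steers_to_zero \<omega> T u f0 \<and> L2_norm ?M u \<le> exp T * C"
    if "0 < C" and bound: "\<And>p. cmod (L2_cinner f0 (L2T_of (poly p))) \<le> C * bergman_norm (sector \<omega> T) (poly p)" for C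
  proof -
    \<comment> \<open>The minus sign is there because the control has to cancel the free evolution.
      The functional is conjugate linear since \<open>p\<close> stands in the second slot of the
      inner product, and the factor \<open>exp T\<close> in the bound is the one from
      \<open>bergman_norm_le\<close>.\<close>
    obtain u where u: "u \<in> L2_fun ?M" "L2_norm ?M u \<le> exp T * C"
      "\<And>p. L2_inner ?M u (poly_polar p) = - L2_cinner f0 (L2T_of (poly p))"
    proof (rule L2_Riesz_subspace[where M="?M" and E=poly_polar and sc=smult and K="exp T * C"
          and \<phi>="\<lambda>p. - L2_cinner f0 (L2T_of (poly p))"])
      show "finite_measure ?M" by (rule finite_measure_control[OF \<omega>(1)])
      show "poly_polar p \<in> L2_fun ?M" for p by (rule poly_polar_L2[OF \<omega>])
      have "poly (p + q) = (\<lambda>z. poly p z + poly q z)" "poly (smult c p) = (\<lambda>z. c * poly p z)" for p q :: "complex poly" and c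
        by auto
      then show "- L2_cinner f0 (L2T_of (poly (p + q))) = - L2_cinner f0 (L2T_of (poly p)) + - L2_cinner f0 (L2T_of (poly q))"
        and "- L2_cinner f0 (L2T_of (poly (smult c p))) = cnj c * - L2_cinner f0 (L2T_of (poly p))" for p q c
        unfolding pairing using h(1) by (simp_all add: L2_inner_add_right L2_inner_cmult_right L2_fun_circle_poly)
      show "cmod (- L2_cinner f0 (L2T_of (poly p))) \<le> exp T * C * L2_norm ?M (poly_polar p)" for p
      proof -
        have "cmod (- L2_cinner f0 (L2T_of (poly p))) \<le> C * bergman_norm (sector \<omega> T) (poly p)"
          using bound by simp
        also have "\<dots> \<le> C * (exp T * L2_norm ?M (poly_polar p))"
          using \<open>0 < C\<close> by (intro mult_left_mono bergman_norm_le[OF \<omega> assms(3)]) auto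
        finally show ?thesis by (simp add: mult_ac)
      qed
    qed (use \<open>0 < C\<close> in \<open>auto simp: poly_polar_def\<close>)
    then have "steers_to_zero \<omega> T u f0"
      using assms(3,4) by (subst steers_to_zero_iff[OF \<omega>]) auto
    with u show ?thesis by blast
  qed
  have bound: "\<exists>C>0. \<forall>p. cmod (L2_cinner f0 (L2T_of (poly p))) \<le> C * bergman_norm (sector \<omega> T) (poly p)"
    if u: "u \<in> L2_fun ?M" and z: "steers_to_zero \<omega> T u f0" for u
  \<comment> \<open>The added 1 keeps the constant positive when the control has norm 0.\<close>
  proof (intro exI[of _ "L2_norm ?M u + 1"] conjI allI)
    show "0 < L2_norm ?M u + 1" using L2_norm_nonneg[of ?M u] by simp
    fix p
    have "cmod (L2_cinner f0 (L2T_of (poly p))) = cmod (L2_inner ?M u (poly_polar p))"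
      using z assms(3,4) by (simp add: steers_to_zero_iff[OF \<omega> u])
    also have "\<dots> \<le> L2_norm ?M u * L2_norm ?M (poly_polar p)"
      by (rule L2_Cauchy_Schwarz[OF u poly_polar_L2[OF \<omega>]])
    also have "\<dots> \<le> (L2_norm ?M u + 1) * bergman_norm (sector \<omega> T) (poly p)"
      by (intro mult_mono L2_norm_poly_polar_le[OF \<omega> assms(3)]) (auto simp: L2_norm_nonneg)
    finally show "cmod (L2_cinner f0 (L2T_of (poly p))) \<le> (L2_norm ?M u + 1) * bergman_norm (sector \<omega> T) (poly p)" .
  qed
  have "f0 \<in> null_controllable \<omega> T \<longleftrightarrow>
      (\<exists>C>0. \<forall>p. cmod (L2_cinner f0 (L2T_of (poly p))) \<le> C * bergman_norm (sector \<omega> T) (poly p))"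
    using steer bound assms(4) unfolding null_controllable_def by blast
  with steer show ?thesis by blast
qed

end
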